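(* Let $\{(x^k,y^k,\omega^k)\}$ be a sequence generated by iADMM (defined in the context), with $\alpha\in(0,2)$. Suppose $\mu:=\eta_y-\frac{\alpha_2L_h^2}{\beta}>0$, $\eta_i>0$ for all $i\in[s]$, and that for some constants $0<C_x,C_y<1$ and all $k\ge 1$, $i\in[s]$, $$\gamma_i^k\le C_x\eta_i,\qquad \frac{4\alpha_2L_h^2\delta_{k-1}^2}{\beta}\le C_2\mu,\qquad \frac{\alpha_2L_h^2\bar\delta_k}{\beta}+\gamma_y^k\le C_1\mu,$$ where $C_1=C_y$, $C_2=0$ if $\delta_k=0$ for all $k$, and $0<C_1<C_y$, $C_2=C_y-C_1$ otherwise. Suppose furthermore that one of the following holds: (1) $\delta_k=0$ for all $k$; or (2) extrapolation is used in the update of $y$ and, for all $k\geq 1$, $$\beta\ge\frac{4L_h\alpha}{\sigma_{\mathcal B}(1-|1-\alpha|)},\qquad \beta\ge\frac{6\alpha L_h^2}{\mu\,\sigma_{\mathcal B}(1-|1-\alpha|)}\max\Big\{1,\frac{12\delta_k^2}{1-C_1}\Big\}.$$ If the generated sequence $\{(x^k,y^k,\omega^k)\}$ is bounded, then every limit point $(x^*,y^*,\omega^* )$ of it is a critical point of $\mathcal L$, i.e. $0\in\partial\mathcal L(x^*,y^*,\omega^* )$.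
   Context: **Problem.** Write $[s]=\{1,\dots,s\}$. Let $x=(x_1,\dots,x_s)\in\mathbb R^{n}$ with $x_i\in\mathbb R^{n_i}$, $n=\sum_i n_i$, and $y\in\mathbb R^q$. Consider $\min_{x,y}F(x)+h(y)$ subject to $\mathcal Ax+\mathcal By=b$, where $\mathcal Ax=\sum_{i=1}^s\mathcal A_ix_i$, $\mathcal A_i:\mathbb R^{n_i}\to\mathbb R^m$ and $\mathcal B:\mathbb R^q\to\mathbb R^m$ are linear, $b\in\mathbb R^m$, $h:\mathbb R^q\to\mathbb R$ is differentiable, $F(x)=f(x)+\sum_{i=1}^sg_i(x_i)$, $f:\mathbb R^n\to\mathbb R$ (possibly nonconvex and nonsmooth), $g_i:\mathbb R^{n_i}\to\mathbb R\cup\{+\infty\}$ proper lower semicontinuous. $\partial$ is the limiting subdifferential and $\partial_{x_i}$ the limiting subdifferential with respect to block $x_i$ (other variables fixed); it is assumed that $\partial F(x)=\partial_{x_1}F(x)\times\dots\times\partial_{x_s}F(x)$. A critical point of a function is a point of its domain at which $0$ belongs to the limiting subdifferential. $\|\cdot\|$ is the Euclidean/operator norm, $\mathcal M^*$ the adjoint, $\lambda_{\min}$ the smallest eigenvalue. $(x_i,z_{\neq i})$ denotes $(z_1,\dots,z_{i-1},x_i,z_{i+1},\dots,z_s)$. Augmented Lagrangian ($\beta>0$): $\mathcal L(x,y,\omega)=F(x)+h(y)+\langle\omega,\mathcal Ax+\mathcal By-b\rangle+\frac\beta2\|\mathcal Ax+\mathcal By-b\|^2$. **Standing assumptions.** $\sigma_{\mathcal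 B}:=\lambda_{\min}(\mathcal B\mathcal B^* )>0$; $F(x)+h(y)$ is bounded below; $\nabla h$ is $L_h$-Lipschitz. For each $i$, $u_i:\mathbb R^{n_i}\times\mathbb R^n\to\mathbb R$ is a block $i$ surrogate of $f$: $u_i(z_i,z)=f(z)$ for all $z$, and $u_i(x_i,z)\ge f(x_i,z_{\ne i})$ for all $x_i,z$. Each $u_i$ is continuous, and for each $z\in\mathbb R^n$ there is a function $\bar e_i(\cdot,z)$, continuously differentiable at $z_i$, with $\bar e_i(z_i,z)=0$, $\nabla_{x_i}\bar e_i(z_i,z)=0$ and $u_i(x_i,z)-f(x_i,z_{\ne i})\le\bar e_i(x_i,z)$ for all $x_i$. **iADMM.** Parameters: $\alpha\in(0,2)$, $\beta>0$, $\kappa_i\ge\|\mathcal A_i^*\mathcal A_i\|$, extrapolation parameters $\zeta_i^k$, $\delta_k$. Start with $x^0=x^{-1}$, $y^0=y^{-1}$, $\omega^0$. For $k=0,1,\dots$: for $i=1,\dots,s$, set $\bar x_i^k=x_i^k+\zeta_i^k(x_i^k-x_i^{k-1})$, $x^{k,i-1}=(x_1^{k+1},\dots,x_{i-1}^{k+1},x_i^k,\dots,x_s^k)$, $\bar x^{k,i-1}=(x_1^{k+1},\dots,x_{i-1}^{k+1},\bar x_i^k,x_{i+1}^k,\dots,x_s^k)$ and $$x_i^{k+1}\in\arg\min_{x_i}\Big\{u_i(x_i,x^{k,i-1})+g_i(x_i)+\langle\mathcal A_i^*(\omega^k+\beta(\mathcal A\bar x^{k,i-1}+\mathcal By^k-b)),x_i\rangle+\tfrac{\kappa_i\beta}2\|x_i-\bar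 x_i^k\|^2\Big\};$$ then with $\hat y^k=y^k+\delta_k(y^k-y^{k-1})$, $$y^{k+1}\in\arg\min_y\Big\{\langle\mathcal B^*\omega^k+\nabla h(\hat y^k),y\rangle+\tfrac\beta2\|\mathcal Ax^{k+1}+\mathcal By-b\|^2+\tfrac{L_h}2\|y-\hat y^k\|^2\Big\},$$ and $\omega^{k+1}=\omega^k+\alpha\beta(\mathcal Ax^{k+1}+\mathcal By^{k+1}-b)$. **Constants.** $\alpha_2=\frac{3\alpha}{\sigma_{\mathcal B}(1-|1-\alpha|)^2}$. $\bar\delta_k=2$ if $\delta_k=0$ for all $k$, and $\bar\delta_k=4(1+\delta_k)^2$ otherwise. $\nu_i,\nu_y\in(0,1)$ are arbitrary constants, with the convention that if there is no extrapolation for $x_i$ ($\zeta_i^k=0$ for all $k$) then $\nu_i=0$ and $\zeta_i^k/\nu_i=0$, and if there is no extrapolation for $y$ ($\delta_k=0$ for all $k$) then $\nu_y=0$ and $\delta_k/\nu_y=0$. For each $i$: in general, $\kappa_i>\|\mathcal A_i^*\mathcal A_i\|$ is chosen and $\eta_i=\frac{(1-\nu_i)(\kappa_i-\|\mathcal A_i^*\mathcal A_i\|)\beta}2$, $\gamma_i^k=\frac{(a_i^k)^2}{2\nu_i(\kappa_i-\|\mathcal A_i^*\mathcal A_i\|)\beta}$ with $a_i^k=\beta\zeta_i^k(\kappa_i+\|\mathcal A_i^*\mathcal A_i\|)$; if $x_i\mapsto u_i(x_i,z)+g_i(x_i)$ is convex (for every $z$), $\kappa_i=\|\mathcal A_i^*\mathcal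 A_i\|$ is taken with $\eta_i=\frac{\beta\|\mathcal A_i^*\mathcal A_i\|}2$, $\gamma_i^k=\frac{\beta\|\mathcal A_i^*\mathcal A_i\|(\zeta_i^k)^2}2$ (if $\|\mathcal A_i^*\mathcal A_i\|=0$ the general choice can be used). For $y$: if $h$ is nonconvex, $\eta_y=\frac{(1-\nu_y)(\beta\lambda_{\min}(\mathcal B^*\mathcal B)+L_h)}2$, $\gamma_y^k=\frac{2L_h^2\delta_k^2}{\nu_y(\beta\lambda_{\min}(\mathcal B^*\mathcal B)+L_h)}$; if $h$ is convex, $\eta_y=\frac{L_h}2$, $\gamma_y^k=\frac{L_h\delta_k^2}2$. *)

theory Defs
  imports "HOL-Analysis.Analysis"
begin

section \<open>Block structure\<close>

text \<open>
  A product of \<open>s\<close> Euclidean spaces of (possibly different) dimensions \<open>n\<^sub>1, \<dots>, n\<^sub>s\<close> is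
  represented by the space \<^typ>\<open>real^'n\<close> together with a map \<open>blk :: 'n \<Rightarrow> nat\<close> that is onto
  \<open>{1..s}\<close> and assigns to each coordinate the block containing it, so that \<open>n\<^sub>i\<close> is the number of
  coordinates \<open>j\<close> with \<open>blk j = i\<close>. The \<open>i\<close>-th factor is the coordinate subspace
  \<open>block_space blk i\<close>, with the induced inner product; functions defined on this factor are
  functions on \<^typ>\<open>real^'n\<close> of which only the values on \<open>block_space blk i\<close> are used.
\<close>

definition block_space :: "('n::finite \<Rightarrow> nat) \<Rightarrow> nat \<Rightarrow> (real^'n) set" where
  "block_space blk i = {v. \<forall>j. blk j \<noteq> i \<longrightarrow> v $ j = 0}"

definition block :: "('n::finite \<Rightarrow> nat) \<Rightarrow> nat \<Rightarrow> real^'n \<Rightarrow> real^'n" where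
  "block blk i x = (\<chi> j. if blk j = i then x $ j else 0)"

text \<open>\<open>with_block blk i v z\<close> is \<open>(z\<^sub>1, \<dots>, z\<^sub>i\<^sub>-\<^sub>1, v, z\<^sub>i\<^sub>+\<^sub>1, \<dots>, z\<^sub>s)\<close>.\<close>

definition with_block :: "('n::finite \<Rightarrow> nat) \<Rightarrow> nat \<Rightarrow> real^'n \<Rightarrow> real^'n \<Rightarrow> real^'n" where
  "with_block blk i v z = (\<chi> j. if blk j = i then v $ j else z $ j)"

text \<open>\<open>partial_update blk i x' x\<close> is \<open>(x'\<^sub>1, \<dots>, x'\<^sub>i\<^sub>-\<^sub>1, x\<^sub>i, \<dots>, x\<^sub>s)\<close>.\<close>

definition partial_update :: "('n::finite \<Rightarrow> nat) \<Rightarrow> nat \<Rightarrow> real^'n \<Rightarrow> real^'n \<Rightarrow> real^'n" where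
  "partial_update blk i x' x = (\<chi> j. if blk j < i then x' $ j else x $ j)"

definition block_map ::
  "('n::finite \<Rightarrow> nat) \<Rightarrow> nat \<Rightarrow> (nat \<Rightarrow> real^'n \<Rightarrow> real^'m::finite) \<Rightarrow> real^'n \<Rightarrow> real^'m" where
  "block_map blk s A x = (\<Sum>i = 1..s. A i (block blk i x))"


section \<open>Extended real valued functions on a linear subspace\<close>

text \<open>
  In this section \<open>S\<close> is meant to be a linear subspace, regarded as a Euclidean space in its own
  right: \<open>S = UNIV\<close> gives the usual notions on the whole space.
\<close>

definition proper_on :: "'a set \<Rightarrow> ('a \<Rightarrow> ereal) \<Rightarrow> bool" where
  "proper_on S f \<longleftrightarrow> (\<forall>x\<in>S. f x \<noteq> -\<infinity>) \<and> (\<exists>x\<in>S. f x \<noteq> \<infinity>)"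

definition lsc_on :: "'a::topological_space set \<Rightarrow> ('a \<Rightarrow> ereal) \<Rightarrow> bool" where
  "lsc_on S f \<longleftrightarrow> (\<forall>x\<in>S. f x \<le> Liminf (at x within S) f)"

definition ereal_convex_on :: "'a::real_vector set \<Rightarrow> ('a \<Rightarrow> ereal) \<Rightarrow> bool" where
  "ereal_convex_on S f \<longleftrightarrow> convex S \<and>
    (\<forall>x\<in>S. \<forall>y\<in>S. \<forall>t. 0 < t \<and> t < 1 \<longrightarrow>
      f ((1 - t) *\<^sub>R x + t *\<^sub>R y) \<le> ereal (1 - t) * f x + ereal t * f y)"

definition frechet_subdiff_on ::
  "'a::euclidean_space set \<Rightarrow> ('a \<Rightarrow> ereal) \<Rightarrow> 'a \<Rightarrow> 'a set" where
  "frechet_subdiff_on S f x = {v \<in> S. x \<in> S \<and> \<bar>f x\<bar> \<noteq> \<infinity> \<and>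
     0 \<le> Liminf (at x within S)
           (\<lambda>y. (f y - f x - ereal (v \<bullet> (y - x))) / ereal (norm (y - x)))}"

definition limiting_subdiff_on ::
  "'a::euclidean_space set \<Rightarrow> ('a \<Rightarrow> ereal) \<Rightarrow> 'a \<Rightarrow> 'a set" where
  "limiting_subdiff_on S f x = {v \<in> S. x \<in> S \<and> \<bar>f x\<bar> \<noteq> \<infinity> \<and>
     (\<exists>X V. X \<longlonglongrightarrow> x \<and> (\<lambda>k. f (X k)) \<longlonglongrightarrow> f x \<and>
            (\<forall>k. V k \<in> frechet_subdiff_on S f (X k)) \<and> V \<longlonglongrightarrow> v)}"

abbreviation limiting_subdiff :: "('a::euclidean_space \<Rightarrow> ereal) \<Rightarrow> 'a \<Rightarrow> 'a set" where
  "limiting_subdiff \<equiv> limiting_subdiff_on UNIV"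

definition critical_point :: "('a::euclidean_space \<Rightarrow> ereal) \<Rightarrow> 'a \<Rightarrow> bool" where
  "critical_point f x \<longleftrightarrow> f x < \<infinity> \<and> 0 \<in> limiting_subdiff f x"

text \<open>
  The limiting subdifferential with respect to block \<open>i\<close>: that of
  \<open>v \<mapsto> F (x\<^sub>1, \<dots>, x\<^sub>i\<^sub>-\<^sub>1, v, x\<^sub>i\<^sub>+\<^sub>1, \<dots>, x\<^sub>s)\<close> at \<open>x\<^sub>i\<close>.
\<close>

definition block_subdiff ::
  "('n::finite \<Rightarrow> nat) \<Rightarrow> nat \<Rightarrow> (real^'n \<Rightarrow> ereal) \<Rightarrow> real^'n \<Rightarrow> (real^'n) set" where
  "block_subdiff blk i F x =
     limiting_subdiff_on (block_space blk i) (\<lambda>v. F (with_block blk i v x)) (block blk i x)"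


section \<open>Smallest eigenvalue\<close>

text \<open>Only used for \<open>T\<close> self-adjoint on a Euclidean space, where the minimum exists.\<close>

definition lambda_min :: "('a::euclidean_space \<Rightarrow> 'a) \<Rightarrow> real" where
  "lambda_min T = (LEAST c. \<exists>v. v \<noteq> 0 \<and> T v = c *\<^sub>R v)"


section \<open>Block surrogate functions\<close>

definition block_surrogate ::
  "('n::finite \<Rightarrow> nat) \<Rightarrow> nat \<Rightarrow> (real^'n \<Rightarrow> real) \<Rightarrow> (real^'n \<Rightarrow> real^'n \<Rightarrow> real) \<Rightarrow> bool" where
  "block_surrogate blk i f u \<longleftrightarrow>
     (\<forall>z. u (block blk i z) z = f z) \<and>
     (\<forall>v\<in>block_space blk i. \<forall>z. f (with_block blk i v z) \<le> u v z)"

text \<open>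
  \<open>e\<close> is differentiable on a neighbourhood of \<open>p\<close> in the subspace \<open>S\<close>, its gradient (an element of
  \<open>S\<close>) is continuous at \<open>p\<close>, and the gradient at \<open>p\<close> is \<open>d\<close>.
\<close>

definition cont_diff_at_on ::
  "'a::euclidean_space set \<Rightarrow> ('a \<Rightarrow> real) \<Rightarrow> 'a \<Rightarrow> 'a \<Rightarrow> bool" where
  "cont_diff_at_on S e p d \<longleftrightarrow>
     (\<exists>U G. open U \<and> p \<in> U \<and>
        (\<forall>w\<in>U \<inter> S. G w \<in> S \<and> (e has_derivative (\<lambda>t. t \<bullet> G w)) (at w within S)) \<and>
        continuous (at p within S) G \<and> G p = d)"

definition surrogate_error_bound ::
  "('n::finite \<Rightarrow> nat) \<Rightarrow> nat \<Rightarrow> (real^'n \<Rightarrow> real) \<Rightarrow> (real^'n \<Rightarrow> real^'n \<Rightarrow> real) \<Rightarrow> bool" where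
  "surrogate_error_bound blk i f u \<longleftrightarrow>
     (\<forall>z. \<exists>e. e (block blk i z) = 0 \<and>
        cont_diff_at_on (block_space blk i) e (block blk i z) 0 \<and>
        (\<forall>v\<in>block_space blk i. u v z - f (with_block blk i v z) \<le> e v))"


section \<open>The optimization problem and the algorithm\<close>

definition composite_obj ::
  "('n::finite \<Rightarrow> nat) \<Rightarrow> nat \<Rightarrow> (real^'n \<Rightarrow> real) \<Rightarrow> (nat \<Rightarrow> real^'n \<Rightarrow> ereal) \<Rightarrow> real^'n \<Rightarrow> ereal"
  where "composite_obj blk s f g x = ereal (f x) + (\<Sum>i = 1..s. g i (block blk i x))"

definition aug_lagrangian ::
  "('a \<Rightarrow> ereal) \<Rightarrow> ('b \<Rightarrow> real) \<Rightarrow> ('a \<Rightarrow> 'c::real_inner) \<Rightarrow> ('b \<Rightarrow> 'c) \<Rightarrow> 'c \<Rightarrow> real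
     \<Rightarrow> 'a \<times> 'b \<times> 'c \<Rightarrow> ereal" where
  "aug_lagrangian F h A B b \<beta> = (\<lambda>(x, y, \<omega>).
     F x + ereal (h y + \<omega> \<bullet> (A x + B y - b) + \<beta> / 2 * (norm (A x + B y - b))\<^sup>2))"

text \<open>
  \<open>gh\<close> is the gradient of \<open>h\<close>. By truncated subtraction on \<^typ>\<open>nat\<close>, \<open>x (k - 1)\<close> and \<open>y (k - 1)\<close>
  are \<open>x 0\<close> and \<open>y 0\<close> for \<open>k = 0\<close>; this is the initialization \<open>x\<^sup>-\<^sup>1 = x\<^sup>0\<close>, \<open>y\<^sup>-\<^sup>1 = y\<^sup>0\<close>.
\<close>

definition iADMM_sequence ::
  "('n::finite \<Rightarrow> nat) \<Rightarrow> nat \<Rightarrow> (nat \<Rightarrow> real^'n \<Rightarrow> real^'n \<Rightarrow> real) \<Rightarrow> (nat \<Rightarrow> real^'n \<Rightarrow> ereal)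
    \<Rightarrow> (real^'q::finite \<Rightarrow> real^'q) \<Rightarrow> real
    \<Rightarrow> (nat \<Rightarrow> real^'n \<Rightarrow> real^'m::finite) \<Rightarrow> (real^'q \<Rightarrow> real^'m) \<Rightarrow> real^'m
    \<Rightarrow> real \<Rightarrow> real \<Rightarrow> (nat \<Rightarrow> real) \<Rightarrow> (nat \<Rightarrow> nat \<Rightarrow> real) \<Rightarrow> (nat \<Rightarrow> real)
    \<Rightarrow> (nat \<Rightarrow> real^'n) \<Rightarrow> (nat \<Rightarrow> real^'q) \<Rightarrow> (nat \<Rightarrow> real^'m) \<Rightarrow> bool" where
  "iADMM_sequence blk s u g gh L\<^sub>h A B b \<alpha> \<beta> \<kappa> \<zeta> \<delta> x y \<omega> \<longleftrightarrow> (\<forall>k.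
     (\<forall>i\<in>{1..s}.
        let xbar\<^sub>i = block blk i (x k + \<zeta> i k *\<^sub>R (x k - x (k - 1)));
            xk = partial_update blk i (x (Suc k)) (x k);
            xbar = with_block blk i xbar\<^sub>i xk
        in is_arg_min
             (\<lambda>v. ereal (u i v xk) + g i v +
                ereal (adjoint (A i) (\<omega> k + \<beta> *\<^sub>R (block_map blk s A xbar + B (y k) - b)) \<bullet> v
                       + \<kappa> i * \<beta> / 2 * (norm (v - xbar\<^sub>i))\<^sup>2))
             (\<lambda>v. v \<in> block_space blk i)
             (block blk i (x (Suc k)))) \<and>
     (let yhat = y k + \<delta> k *\<^sub>R (y k - y (k - 1))
      in is_arg_min
           (\<lambda>w. (adjoint B (\<omega> k) + gh yhat) \<bullet> w
              + \<beta> / 2 * (norm (block_map blk s A (x (Suc k)) + B w - b))\<^sup>2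
              + L\<^sub>h / 2 * (norm (w - yhat))\<^sup>2)
           (\<lambda>w. True)
           (y (Suc k))) \<and>
     \<omega> (Suc k) = \<omega> k + (\<alpha> * \<beta>) *\<^sub>R (block_map blk s A (x (Suc k)) + B (y (Suc k)) - b))"

end

theory Submission
  imports Defs
begin

text \<open>
  The proof has two halves: successive iterates of iADMM get arbitrarily close to each other, and a
  limit of minimizers is a minimizer.

  Vanishing steps. One iteration changes the augmented Lagrangian in three places. Updating block
  \<open>i\<close> lowers it by \<open>\<eta>\<^sub>i \<parallel>x\<^sub>i\<^sup>k\<^sup>+\<^sup>1 - x\<^sub>i\<^sup>k\<parallel>\<^sup>2\<close>, up to the extrapolation error
  \<open>\<gamma>\<^sub>i\<^sup>k \<parallel>x\<^sub>i\<^sup>k - x\<^sub>i\<^sup>k\<^sup>-\<^sup>1\<parallel>\<^sup>2\<close> (\<open>block_descent\<close>); updating \<open>y\<close> does the same with \<open>\<eta>\<^sub>y\<close> and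
  \<open>\<gamma>\<^sub>y\<close> (\<open>y_descent\<close>); updating \<open>\<omega>\<close> raises it by \<open>\<parallel>\<omega>\<^sup>k\<^sup>+\<^sup>1 - \<omega>\<^sup>k\<parallel>\<^sup>2 / (\<alpha>\<beta>)\<close>. The last term is
  controlled because the optimality condition of the \<open>y\<close> update expresses \<open>B\<^sup>*\<omega>\<^sup>k\<^sup>+\<^sup>1\<close> as
  \<open>(1 - \<alpha>) B\<^sup>*\<omega>\<^sup>k - \<alpha> z\<^sup>k\<close>, where the changes of \<open>z\<^sup>k\<close> are bounded by the steps of \<open>y\<close>, and
  \<open>\<parallel>B\<^sup>*v\<parallel>\<^sup>2 \<ge> \<sigma>\<^sub>B \<parallel>v\<parallel>\<^sup>2\<close>: since \<open>\<bar>1 - \<alpha>\<bar> < 1\<close> the recursion is a contraction driven by the steps of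
  \<open>y\<close> (\<open>multiplier_ascent_le\<close>). The parameter conditions say that what is lost in these
  three places is at most a fraction \<open>C\<^sub>x\<close> or \<open>C\<^sub>y\<close> of what is gained, so a Lyapunov function that
  adds weighted squared steps to the Lagrangian decreases (\<open>iteration_descent\<close>,
  \<open>weighted_steps_vanish\<close>). It is bounded below because the multipliers are bounded: by completing
  the square, \<open>\<omega> \<bullet> r + \<beta>/2 \<parallel>r\<parallel>\<^sup>2 \<ge> - \<parallel>\<omega>\<parallel>\<^sup>2 / (2\<beta>)\<close> for every residual \<open>r\<close>. Hence its decrements,
  and with them the steps of \<open>x\<close> and \<open>y\<close>, tend to zero; the contraction then gives the same for
  \<open>\<omega>\<close>, and thus for the constraint residual.

  Limit points. Along a convergent subsequence the subproblems of block \<open>i\<close> converge to the problem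
  of minimizing \<open>u\<^sub>i(v, x\<^sup>*) + g\<^sub>i(v) + A\<^sub>i\<^sup>*\<omega>\<^sup>* \<bullet> v + \<kappa>\<^sub>i\<beta>/2 \<parallel>v - x\<^sub>i\<^sup>*\<parallel>\<^sup>2\<close>, and lower semicontinuity of
  \<open>g\<^sub>i\<close> makes \<open>x\<^sub>i\<^sup>*\<close> a solution of it (\<open>limit_of_argmins\<close>). The surrogate differs from \<open>f\<close> by an
  error that vanishes to first order at \<open>x\<^sub>i\<^sup>*\<close>, as does the proximal term, so \<open>-A\<^sub>i\<^sup>*\<omega>\<^sup>*\<close> is a
  Frechet subgradient of \<open>F\<close> in block \<open>i\<close> (\<open>limit_block_stationary\<close>). The product formula for the
  limiting subdifferential turns this into \<open>-A\<^sup>*\<omega>\<^sup>* \<in> \<partial>F(x\<^sup>*)\<close>. The fixed point of the multiplier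
  recursion is \<open>\<nabla>h(y\<^sup>*) + B\<^sup>*\<omega>\<^sup>* = 0\<close>, the residual at the limit is \<open>0\<close>, and the sum rule with the
  smooth part of the Lagrangian (\<open>limiting_subdiff_add_smooth\<close>) assembles the three conditions.
\<close>

section \<open>Smooth functions, quadratic forms and least squares\<close>

lemma linear_term_vanishes:
  fixes a b :: real
  assumes "\<And>t. 0 \<le> t * a + t\<^sup>2 * b"
  shows "a = 0"
proof (rule ccontr)
  assume "a \<noteq> 0"
  \<comment> \<open>For this \<open>t\<close> the linear term beats the quadratic one, whatever the sign of \<open>b\<close>.\<close>
  define t where "t = - a / (\<bar>b\<bar> + 1)"
  have "t * a + t\<^sup>2 * b \<le> t * a + t\<^sup>2 * \<bar>b\<bar>"
    by (intro add_left_mono mult_left_mono) auto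
  also have "\<dots> = - (a\<^sup>2 / (\<bar>b\<bar> + 1)\<^sup>2)"
    unfolding t_def by (simp add: divide_simps power2_eq_square) (auto simp: algebra_simps)
  also have "\<dots> < 0"
    using \<open>a \<noteq> 0\<close> by (simp add: add_nonneg_pos)
  finally show False
    using assms[of t] by linarith
qed

lemma young_product:
  fixes a c s t :: real
  assumes "0 < c"
  shows "a * s * t \<le> c / 2 * s\<^sup>2 + a\<^sup>2 / (2 * c) * t\<^sup>2"
proof -
  have "0 \<le> (c * s - a * t)\<^sup>2 / (2 * c)"
    using assms by simp
  also have "\<dots> = c / 2 * s\<^sup>2 + a\<^sup>2 / (2 * c) * t\<^sup>2 - a * s * t"
    using assms by (simp add: power2_eq_square field_simps)
  finally show ?thesis by simp
qed

text \<open>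
  Along the segment from \<open>w\<close> to \<open>z\<close> the difference of the two sides has a nonpositive derivative.
\<close>

lemma lipschitz_gradient_upper_bound:
  fixes h :: "'a::real_inner \<Rightarrow> real"
  assumes h: "\<And>w. GDERIV h w :> gh w" and lip: "L-lipschitz_on UNIV gh"
  shows "h z \<le> h w + gh w \<bullet> (z - w) + L / 2 * (norm (z - w))\<^sup>2"
proof -
  define d where "d = z - w"
  define \<phi> where "\<phi> = (\<lambda>t. h (w + t *\<^sub>R d) - t * (gh w \<bullet> d) - L / 2 * t\<^sup>2 * (norm d)\<^sup>2)"
  have deriv: "(\<phi> has_real_derivative
      gh (w + t *\<^sub>R d) \<bullet> d - gh w \<bullet> d - L * t * (norm d)\<^sup>2) (at t)" for t
  proof -
    have "((\<lambda>t. w + t *\<^sub>R d) has_derivative (\<lambda>t. t *\<^sub>R d)) (at t)"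
      by (auto intro!: derivative_eq_intros)
    moreover have "(h has_derivative (\<lambda>v. v \<bullet> gh (w + t *\<^sub>R d))) (at (w + t *\<^sub>R d))"
      using h unfolding gderiv_def by (simp add: inner_commute)
    ultimately have "((\<lambda>t. h (w + t *\<^sub>R d)) has_derivative (\<lambda>r. (r *\<^sub>R d) \<bullet> gh (w + t *\<^sub>R d))) (at t)"
      using has_derivative_compose by blast
    then have "((\<lambda>t. h (w + t *\<^sub>R d)) has_real_derivative gh (w + t *\<^sub>R d) \<bullet> d) (at t)"
      by (simp add: has_field_derivative_def inner_commute mult.commute[of _ "d \<bullet> _"])
    then show ?thesis
      unfolding \<phi>_def by (auto intro!: derivative_eq_intros)
  qed
  have "\<phi> 1 \<le> \<phi> 0"
  proof (rule DERIV_nonpos_imp_nonincreasing[of 0 1 \<phi>])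
    fix t :: real assume "0 \<le> t" "t \<le> 1"
    have "gh (w + t *\<^sub>R d) \<bullet> d - gh w \<bullet> d \<le> norm (gh (w + t *\<^sub>R d) - gh w) * norm d"
      by (metis inner_diff_left norm_cauchy_schwarz)
    also have "\<dots> \<le> L * (t * norm d) * norm d"
      using lipschitz_onD[OF lip, of "w + t *\<^sub>R d" w] \<open>0 \<le> t\<close>
      by (intro mult_right_mono) (auto simp: dist_norm)
    finally show "\<exists>y. (\<phi> has_real_derivative y) (at t) \<and> y \<le> 0"
      using deriv by (intro exI conjI) (auto simp: power2_eq_square)
  qed simp
  then show ?thesis
    by (simp add: \<phi>_def d_def)
qed

lemma convex_gradient_lower_bound:
  fixes h :: "'a::real_inner \<Rightarrow> real"
  assumes h: "GDERIV h w :> v" and conv: "convex_on UNIV h"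
  shows "h w + v \<bullet> (z - w) \<le> h z"
proof -
  define d where "d = z - w"
  have "((\<lambda>t. w + t *\<^sub>R d) has_derivative (\<lambda>t. t *\<^sub>R d)) (at 0)"
    by (auto intro!: derivative_eq_intros)
  moreover have "(h has_derivative (\<lambda>u. u \<bullet> v)) (at (w + 0 *\<^sub>R d))"
    using h unfolding gderiv_def by (simp add: inner_commute)
  ultimately have "((\<lambda>t. h (w + t *\<^sub>R d)) has_derivative (\<lambda>r. (r *\<^sub>R d) \<bullet> v)) (at 0)"
    using has_derivative_compose by blast
  then have "((\<lambda>t. h (w + t *\<^sub>R d)) has_real_derivative v \<bullet> d) (at 0)"
    by (simp add: has_field_derivative_def inner_commute mult.commute[of _ "d \<bullet> _"])
  moreover have "convex_on UNIV (\<lambda>t. h (w + t *\<^sub>R d))"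
  proof (rule convex_onI)
    fix t a c :: real assume t: "0 < t" "t < 1"
    have "w + ((1 - t) *\<^sub>R a + t *\<^sub>R c) *\<^sub>R d = (1 - t) *\<^sub>R (w + a *\<^sub>R d) + t *\<^sub>R (w + c *\<^sub>R d)"
      by (simp add: algebra_simps)
    then show "h (w + ((1 - t) *\<^sub>R a + t *\<^sub>R c) *\<^sub>R d)
        \<le> (1 - t) * h (w + a *\<^sub>R d) + t * h (w + c *\<^sub>R d)"
      using convex_onD[OF conv, of t "w + a *\<^sub>R d" "w + c *\<^sub>R d"] t by simp
  qed simp
  ultimately have "h (w + 1 *\<^sub>R d) - h (w + 0 *\<^sub>R d) \<ge> (v \<bullet> d) * (1 - 0)"
    by (intro convex_on_imp_above_tangent[of UNIV]) auto
  then show ?thesis by (simp add: d_def)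
qed

text \<open>
  The Rayleigh quotient attains its minimum on the unit sphere, and a minimizer is an eigenvector
  because the first variation vanishes there. So the least eigenvalue exists and is this minimum.
\<close>

lemma lambda_min_le_rayleigh:
  fixes T :: "'a::euclidean_space \<Rightarrow> 'a"
  assumes lin: "linear T" and sym: "\<And>v w. T v \<bullet> w = v \<bullet> T w"
  shows "lambda_min T * (norm v)\<^sup>2 \<le> T v \<bullet> v"
proof -
  interpret linear T by fact
  have "\<exists>p\<in>sphere 0 1. \<forall>v\<in>sphere 0 1. T p \<bullet> p \<le> T v \<bullet> v"
  proof (rule continuous_attains_inf)
    show "sphere (0 :: 'a) 1 \<noteq> {}"
      by simp
    show "continuous_on (sphere 0 1) (\<lambda>v. T v \<bullet> v)"
      using lin by (intro continuous_intros linear_continuous_on) (simp add: linear_linear)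
  qed simp
  then obtain p where p: "norm p = 1" and min: "\<And>v. norm v = 1 \<Longrightarrow> T p \<bullet> p \<le> T v \<bullet> v"
    by auto
  define c where "c = T p \<bullet> p"
  have ray: "c * (norm v)\<^sup>2 \<le> T v \<bullet> v" for v
  proof (cases "v = 0")
    case False
    then have "c \<le> T (v /\<^sub>R norm v) \<bullet> (v /\<^sub>R norm v)"
      unfolding c_def by (intro min) auto
    also have "\<dots> = (T v \<bullet> v) / (norm v)\<^sup>2"
      by (simp add: scale power2_eq_square divide_simps)
    finally show ?thesis using False by (simp add: divide_simps)
  qed (simp add: zero)
  have eig: "T p = c *\<^sub>R p"
  proof -
    define w where "w = T p - c *\<^sub>R p"
    have "0 \<le> t * (2 * (w \<bullet> w)) + t\<^sup>2 * (T w \<bullet> w - c * (norm w)\<^sup>2)" for t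
    proof -
      have "0 \<le> T (p + t *\<^sub>R w) \<bullet> (p + t *\<^sub>R w) - c * (norm (p + t *\<^sub>R w))\<^sup>2"
        using ray by simp
      also have "\<dots> = (T p \<bullet> p - c * (p \<bullet> p)) + t * (2 * ((T p - c *\<^sub>R p) \<bullet> w))
          + t\<^sup>2 * (T w \<bullet> w - c * (w \<bullet> w))"
        by (simp only: power2_norm_eq_inner add scale)
           (simp add: inner_simps algebra_simps power2_eq_square
            sym inner_commute[of w p] inner_commute[of w "T p"])
      also have "T p \<bullet> p - c * (p \<bullet> p) = 0"
        using p by (simp add: c_def power2_norm_eq_inner[symmetric])
      finally show ?thesis
        by (simp add: w_def power2_norm_eq_inner)
    qed
    then have "2 * (w \<bullet> w) = 0" by (rule linear_term_vanishes)
    then show ?thesis by (simp add: w_def)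
  qed
  have "lambda_min T = c"
    unfolding lambda_min_def
  proof (rule Least_equality)
    show "\<exists>v. v \<noteq> 0 \<and> T v = c *\<^sub>R v" using eig p by (intro exI[of _ p]) auto
  next
    fix c' assume "\<exists>v. v \<noteq> 0 \<and> T v = c' *\<^sub>R v"
    then obtain v where "v \<noteq> 0" "T v = c' *\<^sub>R v" by auto
    then show "c \<le> c'" using ray[of v] by (simp add: power2_norm_eq_inner)
  qed
  with ray show ?thesis by simp
qed

lemma lambda_min_adjoint_comp_le:
  fixes B :: "'a::euclidean_space \<Rightarrow> 'b::euclidean_space"
  assumes "linear B"
  shows "lambda_min (adjoint B \<circ> B) * (norm v)\<^sup>2 \<le> (norm (B v))\<^sup>2"
proof -
  have "linear (adjoint B \<circ> B)"
    using assms by (intro linear_compose adjoint_linear)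
  moreover have "(adjoint B \<circ> B) v \<bullet> w = v \<bullet> (adjoint B \<circ> B) w" for v w
    by (simp add: adjoint_works[OF assms] adjoint_clauses[OF assms])
  ultimately have "lambda_min (adjoint B \<circ> B) * (norm v)\<^sup>2 \<le> (adjoint B \<circ> B) v \<bullet> v"
    by (rule lambda_min_le_rayleigh)
  also have "\<dots> = (norm (B v))\<^sup>2"
    by (simp add: adjoint_clauses[OF assms] power2_norm_eq_inner)
  finally show ?thesis .
qed

text \<open>
  The bound is in terms of the norm of \<open>A\<^sup>*A\<close>, which is the quantity that the step sizes
  \<open>\<kappa>\<^sub>i\<close> are compared with.
\<close>

lemma norm_le_onorm_adjoint_comp:
  fixes A :: "'a::euclidean_space \<Rightarrow> 'b::euclidean_space"
  assumes "linear A"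
  shows "(norm (A v))\<^sup>2 \<le> onorm (adjoint A \<circ> A) * (norm v)\<^sup>2"
proof -
  have "linear (adjoint A \<circ> A)"
    using assms by (intro linear_compose adjoint_linear)
  then have "bounded_linear (adjoint A \<circ> A)"
    by (simp add: linear_linear)
  then have "norm (adjoint A (A v)) \<le> onorm (adjoint A \<circ> A) * norm v"
    using onorm[of "adjoint A \<circ> A" v] by simp
  moreover have "(norm (A v))\<^sup>2 = v \<bullet> adjoint A (A v)"
    by (simp add: adjoint_works[OF assms] power2_norm_eq_inner)
  moreover have "v \<bullet> adjoint A (A v) \<le> norm v * norm (adjoint A (A v))"
    by (rule norm_cauchy_schwarz)
  moreover have "norm v * norm (adjoint A (A v)) \<le> norm v * (onorm (adjoint A \<circ> A) * norm v)"
    using calculation(1) by (simp add: mult_left_mono)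
  ultimately show ?thesis
    by (simp add: power2_eq_square algebra_simps)
qed

section \<open>Sequences tending to zero\<close>

lemma tendsto_0_comparison:
  fixes f :: "'a \<Rightarrow> 'b::real_normed_vector" and e :: "'a \<Rightarrow> real"
  assumes "\<And>k. norm (f k) \<le> e k" and "(e \<longlongrightarrow> 0) F"
  shows "(f \<longlongrightarrow> 0) F"
  using assms by (intro Lim_null_comparison[of f e] always_eventually) auto

lemma decrease_tendsto_0:
  fixes \<Phi> D :: "nat \<Rightarrow> real"
  assumes dec: "\<And>k. \<Phi> (Suc k) + D k \<le> \<Phi> k" and nonneg: "\<And>k. 0 \<le> D k"
    and below: "\<And>k. c \<le> \<Phi> k"
  shows "D \<longlonglongrightarrow> 0"
proof -
  have "decseq \<Phi>"
    by (rule decseq_SucI) (use dec nonneg in \<open>smt (verit)\<close>)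
  then obtain l where l: "\<Phi> \<longlonglongrightarrow> l"
    using decseq_convergent[of \<Phi> c] below by blast
  then have "(\<lambda>k. \<Phi> k - \<Phi> (Suc k)) \<longlonglongrightarrow> l - l"
    by (intro tendsto_diff LIMSEQ_Suc)
  then have "(\<lambda>k. \<Phi> k - \<Phi> (Suc k)) \<longlonglongrightarrow> 0" by simp
  moreover have "norm (D k) \<le> \<Phi> k - \<Phi> (Suc k)" for k
    using dec[of k] nonneg[of k] by simp
  ultimately show ?thesis
    by (rule tendsto_0_comparison[rotated])
qed

text \<open>
  Once \<open>e\<close> is below \<open>(1 - q) r/2\<close>, the distance of \<open>a\<close> above the level \<open>r/2\<close> shrinks geometrically.
\<close>

lemma perturbed_contraction_tendsto_0:
  fixes a e :: "nat \<Rightarrow> real"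
  assumes rec: "\<And>k. a (Suc k) \<le> q * a k + e k" and a: "\<And>k. 0 \<le> a k"
    and q: "0 \<le> q" "q < 1" and e: "e \<longlonglongrightarrow> 0"
  shows "a \<longlonglongrightarrow> 0"
proof (rule LIMSEQ_I)
  fix r :: real assume "0 < r"
  then have "0 < (1 - q) * (r / 2)" using q by simp
  then obtain N where N: "\<And>k. N \<le> k \<Longrightarrow> e k < (1 - q) * (r / 2)"
    using order_tendstoD(2)[OF e] unfolding eventually_sequentially by blast
  have bound: "a (N + j) \<le> r / 2 + q ^ j * a N" for j
  proof (induction j)
    case (Suc j)
    have "a (N + Suc j) \<le> q * a (N + j) + e (N + j)" using rec[of "N + j"] by simp
    also have "\<dots> \<le> q * (r / 2 + q ^ j * a N) + (1 - q) * (r / 2)"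
      using Suc q N[of "N + j"] by (intro add_mono mult_left_mono) auto
    finally show ?case by (simp add: field_simps)
  qed (use \<open>0 < r\<close> in simp)
  have "(\<lambda>j. q ^ j * a N) \<longlonglongrightarrow> 0 * a N"
    using q by (intro tendsto_mult_right LIMSEQ_power_zero) simp
  then obtain M where M: "\<And>j. M \<le> j \<Longrightarrow> q ^ j * a N < r / 2"
    using order_tendstoD(2)[of _ "0 * a N" sequentially "r / 2"] \<open>0 < r\<close>
    unfolding eventually_sequentially by auto
  show "\<exists>no. \<forall>k\<ge>no. norm (a k - 0) < r"
  proof (intro exI[of _ "N + M"] allI impI)
    fix k assume "N + M \<le> k"
    then obtain j where "k = N + j" "M \<le> j"
      by (intro that[of "k - N"]) auto
    then show "norm (a k - 0) < r"
      using bound[of j] M[of j] a[of k] by simp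
  qed
qed

text \<open>
  Both facts come from the exact second-order expansion of the objective around the minimizer: its
  linear term must vanish, and what remains is the growth by the two quadratic terms.
\<close>

lemma regularized_least_squares_argmin:
  fixes B :: "'a::euclidean_space \<Rightarrow> 'b::euclidean_space"
  assumes B: "linear B"
    and argmin: "is_arg_min (\<lambda>w. c \<bullet> w + \<beta> / 2 * (norm (r + B w))\<^sup>2 + L / 2 * (norm (w - p))\<^sup>2)
      (\<lambda>w. True) w0"
  shows "c + \<beta> *\<^sub>R adjoint B (r + B w0) + L *\<^sub>R (w0 - p) = 0" (is "?G = 0")
    and "c \<bullet> w + \<beta> / 2 * (norm (r + B w))\<^sup>2 + L / 2 * (norm (w - p))\<^sup>2 =
      c \<bullet> w0 + \<beta> / 2 * (norm (r + B w0))\<^sup>2 + L / 2 * (norm (w0 - p))\<^sup>2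
        + \<beta> / 2 * (norm (B (w - w0)))\<^sup>2 + L / 2 * (norm (w - w0))\<^sup>2"
proof -
  let ?q = "\<lambda>w. c \<bullet> w + \<beta> / 2 * (norm (r + B w))\<^sup>2 + L / 2 * (norm (w - p))\<^sup>2"
  let ?Q = "\<lambda>d. \<beta> / 2 * (norm (B d))\<^sup>2 + L / 2 * (norm d)\<^sup>2"
  interpret B: linear B by fact
  have expand: "?q (w0 + d) = ?q w0 + ?G \<bullet> d + ?Q d" for d
  proof -
    have "adjoint B (r + B w0) \<bullet> d = (r + B w0) \<bullet> B d"
      by (rule adjoint_clauses[OF B])
    then show ?thesis
      by (simp only: B.add power2_norm_eq_inner inner_simps) (simp add: inner_commute field_simps)
  qed
  have "0 \<le> t * (?G \<bullet> ?G) + t\<^sup>2 * ?Q ?G" for t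
  proof -
    have "?q w0 \<le> ?q (w0 + t *\<^sub>R ?G)"
      using argmin by (simp add: is_arg_min_linorder)
    then have "0 \<le> ?G \<bullet> (t *\<^sub>R ?G) + ?Q (t *\<^sub>R ?G)"
      unfolding expand by linarith
    also have "?Q (t *\<^sub>R ?G) = t\<^sup>2 * ?Q ?G"
      by (simp only: B.scale norm_scaleR power_mult_distrib power2_abs)
         (simp add: algebra_simps)
    finally show ?thesis by simp
  qed
  then have "?G \<bullet> ?G = 0" by (rule linear_term_vanishes)
  then show G: "?G = 0" by simp
  show "?q w = ?q w0 + \<beta> / 2 * (norm (B (w - w0)))\<^sup>2 + L / 2 * (norm (w - w0))\<^sup>2"
    using expand[of "w - w0"] G by simp
qed

section \<open>Frechet and limiting subdifferentials\<close>

text \<open>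
  Clearing the quotient in the definition: a Frechet subgradient is the slope of an affine
  minorant up to an arbitrarily small multiple of the distance. This form avoids the arithmetic of
  extended reals under the limit inferior.
\<close>

lemma frechet_subdiff_on_iff:
  "v \<in> frechet_subdiff_on S f x \<longleftrightarrow> v \<in> S \<and> x \<in> S \<and> \<bar>f x\<bar> \<noteq> \<infinity> \<and>
     (\<forall>\<epsilon>>0. \<forall>\<^sub>F y in at x within S. f x + ereal (v \<bullet> (y - x) - \<epsilon> * norm (y - x)) \<le> f y)"
proof (cases "v \<in> S \<and> x \<in> S \<and> \<bar>f x\<bar> \<noteq> \<infinity>")
  case True
  then obtain a where a: "f x = ereal a" by (cases "f x") auto
  let ?q = "\<lambda>y. (f y - f x - ereal (v \<bullet> (y - x))) / ereal (norm (y - x))"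
  have quot: "ereal (- \<epsilon>) \<le> ?q y \<longleftrightarrow> f x + ereal (v \<bullet> (y - x) - \<epsilon> * norm (y - x)) \<le> f y"
    if "y \<noteq> x" for y \<epsilon>
    using that by (cases "f y") (auto simp: a field_simps)
  have ev: "(\<forall>\<^sub>F y in at x within S. ereal (- \<epsilon>) \<le> ?q y) \<longleftrightarrow>
      (\<forall>\<^sub>F y in at x within S. f x + ereal (v \<bullet> (y - x) - \<epsilon> * norm (y - x)) \<le> f y)" for \<epsilon>
    unfolding eventually_at_filter by (intro arg_cong2[where f = eventually] ext) (use quot in auto)
  have "0 \<le> Liminf (at x within S) ?q \<longleftrightarrow> (\<forall>\<epsilon>>0. \<forall>\<^sub>F y in at x within S. ereal (- \<epsilon>) \<le> ?q y)"
    unfolding le_Liminf_iff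
  proof (intro iffI allI impI)
    fix \<epsilon> :: real assume "\<forall>c<0. \<forall>\<^sub>F y in at x within S. c < ?q y" "0 < \<epsilon>"
    then have "\<forall>\<^sub>F y in at x within S. ereal (- \<epsilon>) < ?q y" by simp
    then show "\<forall>\<^sub>F y in at x within S. ereal (- \<epsilon>) \<le> ?q y"
      by (rule eventually_mono) simp
  next
    fix c :: ereal
    assume *: "\<forall>\<epsilon>>0. \<forall>\<^sub>F y in at x within S. ereal (- \<epsilon>) \<le> ?q y" and "c < 0"
    then obtain r where r: "c < ereal r" "ereal r < 0" by (meson ereal_dense2)
    then have "0 < - r" by (simp add: zero_ereal_def)
    then have "\<forall>\<^sub>F y in at x within S. ereal (- (- r)) \<le> ?q y"
      using * by blast
    then show "\<forall>\<^sub>F y in at x within S. c < ?q y"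
      by (rule eventually_mono) (use r in auto)
  qed
  with True show ?thesis
    by (simp add: frechet_subdiff_on_def ev)
qed (auto simp: frechet_subdiff_on_def)

lemma frechet_subdiff_on_subset_limiting:
  "frechet_subdiff_on S f x \<subseteq> limiting_subdiff_on S f x"
proof
  fix v assume v: "v \<in> frechet_subdiff_on S f x"
  then show "v \<in> limiting_subdiff_on S f x"
    unfolding limiting_subdiff_on_def mem_Collect_eq
    by (intro conjI exI[of _ "\<lambda>_. x"] exI[of _ "\<lambda>_. v"] allI)
       (simp_all add: frechet_subdiff_on_def)
qed

text \<open>
  This is how first-order small perturbations, such as surrogate errors and proximal terms, are
  discarded.
\<close>

lemma frechet_subdiff_on_minorant:
  assumes "x \<in> S" "v \<in> S" "\<bar>f x\<bar> \<noteq> \<infinity>"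
    and deriv: "(e has_derivative (\<lambda>_. 0)) (at x within S)" and "e x = (0::real)"
    and minorant: "\<And>y. y \<in> S \<Longrightarrow> f x + ereal (v \<bullet> (y - x) - e y) \<le> f y"
  shows "v \<in> frechet_subdiff_on S f x"
  unfolding frechet_subdiff_on_iff
proof (intro conjI allI impI)
  fix \<epsilon> :: real assume "0 < \<epsilon>"
  then obtain d where d: "0 < d" "\<And>y. y \<in> S \<Longrightarrow> norm (y - x) < d \<Longrightarrow> \<bar>e y\<bar> \<le> \<epsilon> * norm (y - x)"
    using deriv \<open>e x = 0\<close> unfolding has_derivative_within_alt by auto
  show "\<forall>\<^sub>F y in at x within S. f x + ereal (v \<bullet> (y - x) - \<epsilon> * norm (y - x)) \<le> f y"
    unfolding eventually_at
  proof (intro exI[of _ d] conjI ballI impI \<open>0 < d\<close>)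
    fix y assume y: "y \<in> S" "y \<noteq> x \<and> dist y x < d"
    then have "e y \<le> \<epsilon> * norm (y - x)"
      using d(2)[of y] by (auto simp: dist_norm)
    then have "f x + ereal (v \<bullet> (y - x) - \<epsilon> * norm (y - x)) \<le> f x + ereal (v \<bullet> (y - x) - e y)"
      by (intro add_left_mono) simp
    also have "\<dots> \<le> f y" using minorant y by simp
    finally show "f x + ereal (v \<bullet> (y - x) - \<epsilon> * norm (y - x)) \<le> f y" .
  qed
qed (use assms in auto)

text \<open>
  The sum rule for a function of two variables of which only the smooth summand depends on the
  second one: half of the admissible error \<open>\<epsilon>\<close> is spent on each summand.
\<close>

lemma frechet_subdiff_add_smooth:
  fixes F :: "'a::euclidean_space \<Rightarrow> ereal" and \<phi> :: "'a \<times> 'b::euclidean_space \<Rightarrow> real"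
  assumes v: "v \<in> frechet_subdiff_on UNIV F x" and \<phi>: "GDERIV \<phi> (x, y) :> G"
  shows "(v, 0) + G \<in> frechet_subdiff_on UNIV (\<lambda>(x, y). F x + ereal (\<phi> (x, y))) (x, y)"
  unfolding frechet_subdiff_on_iff
proof (intro conjI allI impI)
  from v obtain a where a: "F x = ereal a"
    by (cases "F x") (auto simp: frechet_subdiff_on_iff)
  then show "\<bar>case (x, y) of (x, y) \<Rightarrow> F x + ereal (\<phi> (x, y))\<bar> \<noteq> \<infinity>" by simp
  fix \<epsilon> :: real assume "0 < \<epsilon>"
  then have "0 < \<epsilon> / 2" by simp
  then have "\<forall>\<^sub>F z in at x. F x + ereal (v \<bullet> (z - x) - \<epsilon> / 2 * norm (z - x)) \<le> F z"
    using v unfolding frechet_subdiff_on_iff by blast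
  then have "\<forall>\<^sub>F z in nhds x. F x + ereal (v \<bullet> (z - x) - \<epsilon> / 2 * norm (z - x)) \<le> F z"
    unfolding eventually_at_filter
  proof (rule eventually_mono)
    fix z assume *: "z \<noteq> x \<longrightarrow> z \<in> UNIV \<longrightarrow>
      F x + ereal (v \<bullet> (z - x) - \<epsilon> / 2 * norm (z - x)) \<le> F z"
    show "F x + ereal (v \<bullet> (z - x) - \<epsilon> / 2 * norm (z - x)) \<le> F z"
      by (cases "z = x") (use * in \<open>simp_all add: a\<close>)
  qed
  then have F: "\<forall>\<^sub>F p in at (x, y). F x + ereal (v \<bullet> (fst p - x) - \<epsilon> / 2 * norm (fst p - x)) \<le> F (fst p)"
    by (rule eventually_compose_filterlim) (use tendsto_fst[OF tendsto_ident_at, of "(x, y)"] in simp)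
  obtain d where d: "0 < d"
    "\<And>p. norm (p - (x, y)) < d \<Longrightarrow>
      \<bar>\<phi> p - \<phi> (x, y) - (p - (x, y)) \<bullet> G\<bar> \<le> \<epsilon> / 2 * norm (p - (x, y))"
    using \<phi> \<open>0 < \<epsilon> / 2\<close> unfolding gderiv_def has_derivative_at_alt real_norm_def by blast
  have "\<forall>\<^sub>F p in at (x, y). norm (p - (x, y)) < d"
    unfolding eventually_at using \<open>0 < d\<close> by (auto simp: dist_norm)
  with F show "\<forall>\<^sub>F p in at (x, y). (case (x, y) of (x, y) \<Rightarrow> F x + ereal (\<phi> (x, y)))
      + ereal (((v, 0) + G) \<bullet> (p - (x, y)) - \<epsilon> * norm (p - (x, y)))
      \<le> (case p of (x, y) \<Rightarrow> F x + ereal (\<phi> (x, y)))"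
  proof eventually_elim
    case (elim p)
    have "norm (fst p - x) \<le> norm (p - (x, y))"
      using norm_fst_le[of "fst p - x" "snd p - y"] by (cases p) simp
    then have "\<epsilon> / 2 * norm (fst p - x) \<le> \<epsilon> / 2 * norm (p - (x, y))"
      using \<open>0 < \<epsilon>\<close> by simp
    moreover have "- (\<epsilon> / 2 * norm (p - (x, y))) \<le> \<phi> p - \<phi> (x, y) - (p - (x, y)) \<bullet> G"
      using d(2)[OF elim(2)] by linarith
    moreover have "((v, 0) + G) \<bullet> (p - (x, y)) = v \<bullet> (fst p - x) + (p - (x, y)) \<bullet> G"
      by (cases p) (simp add: inner_add_left inner_commute[of G])
    ultimately have "\<phi> (x, y) + (((v, 0) + G) \<bullet> (p - (x, y)) - \<epsilon> * norm (p - (x, y)))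
        \<le> v \<bullet> (fst p - x) - \<epsilon> / 2 * norm (fst p - x) + \<phi> p"
      by argo
    then have "ereal (a + \<phi> (x, y)) + ereal (((v, 0) + G) \<bullet> (p - (x, y)) - \<epsilon> * norm (p - (x, y)))
        \<le> (F x + ereal (v \<bullet> (fst p - x) - \<epsilon> / 2 * norm (fst p - x))) + ereal (\<phi> p)"
      by (simp add: a)
    also have "\<dots> \<le> F (fst p) + ereal (\<phi> p)"
      by (intro add_right_mono elim)
    finally show ?case
      by (cases p) (simp add: a)
  qed
qed auto

lemma limiting_subdiff_add_smooth:
  fixes F :: "'a::euclidean_space \<Rightarrow> ereal" and \<phi> :: "'a \<times> 'b::euclidean_space \<Rightarrow> real"
  assumes v: "v \<in> limiting_subdiff F x" and \<phi>: "\<And>p. GDERIV \<phi> p :> G p"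
    and G: "continuous (at (x, y)) G"
  shows "(v, 0) + G (x, y) \<in> limiting_subdiff (\<lambda>(x, y). F x + ereal (\<phi> (x, y))) (x, y)"
proof -
  from v obtain X V where X: "X \<longlonglongrightarrow> x" and FX: "(\<lambda>k. F (X k)) \<longlonglongrightarrow> F x"
    and V: "\<And>k. V k \<in> frechet_subdiff_on UNIV F (X k)" "V \<longlonglongrightarrow> v" and fin: "\<bar>F x\<bar> \<noteq> \<infinity>"
    unfolding limiting_subdiff_on_def by auto
  have pair: "(\<lambda>k. (X k, y)) \<longlonglongrightarrow> (x, y)"
    by (intro tendsto_Pair X tendsto_const)
  have "isCont \<phi> (x, y)"
    using \<phi>[of "(x, y)"] unfolding gderiv_def by (rule has_derivative_continuous)
  then have "(\<lambda>k. ereal (\<phi> (X k, y))) \<longlonglongrightarrow> ereal (\<phi> (x, y))"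
    by (rule tendsto_ereal[OF isCont_tendsto_compose, OF _ pair])
  then have "(\<lambda>k. F (X k) + ereal (\<phi> (X k, y))) \<longlonglongrightarrow> F x + ereal (\<phi> (x, y))"
    using fin by (intro tendsto_add_ereal_general FX) auto
  moreover have "(\<lambda>k. (V k, 0) + G (X k, y)) \<longlonglongrightarrow> (v, 0) + G (x, y)"
    by (intro tendsto_add tendsto_Pair V(2) tendsto_const isCont_tendsto_compose[OF G pair])
  ultimately show ?thesis
    unfolding limiting_subdiff_on_def mem_Collect_eq
    using pair fin frechet_subdiff_add_smooth[OF V(1) \<phi>]
    by (intro conjI exI[of _ "\<lambda>k. (X k, y)"] exI[of _ "\<lambda>k. (V k, 0) + G (X k, y)"] allI)
       (simp_all only: prod.case UNIV_I, auto)
qed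

section \<open>Limits of minimizers\<close>

lemma lsc_on_le_limit:
  assumes lsc: "lsc_on S g" and "p \<in> S" "\<And>k. P k \<in> S" "P \<longlonglongrightarrow> p"
    and le: "\<And>k. g (P k) \<le> R k" and R: "R \<longlonglongrightarrow> r"
  shows "g p \<le> r"
proof -
  have "g p \<le> liminf (\<lambda>k. g (P k))"
    unfolding le_Liminf_iff
  proof (intro allI impI)
    fix c assume c: "c < g p"
    have "\<forall>\<^sub>F z in at p within S. c < g z"
      using lsc \<open>p \<in> S\<close> c by (simp add: lsc_on_def le_Liminf_iff)
    then have "\<forall>\<^sub>F z in nhds p. z \<in> S \<longrightarrow> c < g z"
      unfolding eventually_at_filter by (rule eventually_mono) (use c in auto)
    then have "\<forall>\<^sub>F k in sequentially. P k \<in> S \<longrightarrow> c < g (P k)"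
      using assms(4) by (rule eventually_compose_filterlim)
    then show "\<forall>\<^sub>F k in sequentially. c < g (P k)"
      using assms(3) by simp
  qed
  also have "\<dots> \<le> liminf R"
    by (intro Liminf_mono always_eventually allI le)
  also have "\<dots> = r"
    using R by (intro lim_imp_Liminf) auto
  finally show ?thesis .
qed

text \<open>
  The limit point \<open>p\<close> is also the limit of the proximal centres, so the proximal term disappears at
  \<open>p\<close> itself but not at its competitors. Minimality along the sequence bounds \<open>g (P k)\<close> from above by
  quantities with a limit, and lower semicontinuity transfers this bound to \<open>g p\<close>.
\<close>

lemma limit_of_argmins:
  fixes p :: "'a::euclidean_space" and U :: "'a \<Rightarrow> 'b::topological_space \<Rightarrow> real"
  assumes g: "proper_on S g" "lsc_on S g"
    and U: "continuous_on (S \<times> UNIV) (\<lambda>(v, z). U v z)"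
    and argmin: "\<And>k. is_arg_min
        (\<lambda>v. ereal (U v (Z k)) + g v + ereal (C k \<bullet> v + K / 2 * (norm (v - Q k))\<^sup>2))
        (\<lambda>v. v \<in> S) (P k)"
    and p: "p \<in> S" "P \<longlonglongrightarrow> p" and lims: "Z \<longlonglongrightarrow> z" "C \<longlonglongrightarrow> c" "Q \<longlonglongrightarrow> p"
  shows "\<bar>g p\<bar> \<noteq> \<infinity>"
    and "\<And>v. v \<in> S \<Longrightarrow>
      g p + ereal (U p z + c \<bullet> p) \<le> g v + ereal (U v z + c \<bullet> v + K / 2 * (norm (v - p))\<^sup>2)"
proof -
  have P: "P k \<in> S" for k
    using argmin[of k] by (simp add: is_arg_min_def)
  have lim_U: "(\<lambda>k. U (W k) (Z k)) \<longlonglongrightarrow> U w z" if "W \<longlonglongrightarrow> w" "\<And>k. W k \<in> S" "w \<in> S" for W w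
    using continuous_on_tendsto_compose[OF U, of "\<lambda>k. (W k, Z k)" "(w, z)"] that lims(1)
    by (simp add: tendsto_Pair)
  have ineq: "g p \<le> g v + ereal (U v z + c \<bullet> v + K / 2 * (norm (v - p))\<^sup>2 - (U p z + c \<bullet> p))"
    if v: "v \<in> S" for v
  proof (cases "g v")
    case (real \<gamma>)
    let ?R = "\<lambda>k. \<gamma> + (U v (Z k) + C k \<bullet> v + K / 2 * (norm (v - Q k))\<^sup>2)
        - (U (P k) (Z k) + C k \<bullet> P k + K / 2 * (norm (P k - Q k))\<^sup>2)"
    have "g (P k) \<le> ereal (?R k)" for k
    proof -
      have "ereal (U (P k) (Z k)) + g (P k) + ereal (C k \<bullet> P k + K / 2 * (norm (P k - Q k))\<^sup>2)
          \<le> ereal (U v (Z k)) + g v + ereal (C k \<bullet> v + K / 2 * (norm (v - Q k))\<^sup>2)"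
        using argmin[of k] v by (simp add: is_arg_min_linorder)
      then show ?thesis
        using g(1) P[of k] by (cases "g (P k)") (auto simp: real proper_on_def)
    qed
    moreover have "?R \<longlonglongrightarrow> \<gamma> + (U v z + c \<bullet> v + K / 2 * (norm (v - p))\<^sup>2)
        - (U p z + c \<bullet> p + K / 2 * (norm (p - p))\<^sup>2)"
      using lims p P v by (intro tendsto_intros lim_U)
    ultimately have "g p \<le> ereal (\<gamma> + (U v z + c \<bullet> v + K / 2 * (norm (v - p))\<^sup>2)
        - (U p z + c \<bullet> p + K / 2 * (norm (p - p))\<^sup>2))"
      by (rule lsc_on_le_limit[OF g(2) p(1) P p(2) _ tendsto_ereal])
    then show ?thesis by (simp add: real algebra_simps)
  qed (use g(1) v in \<open>auto simp: proper_on_def\<close>)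
  show fin: "\<bar>g p\<bar> \<noteq> \<infinity>"
  proof -
    obtain v where "v \<in> S" "g v \<noteq> \<infinity>"
      using g(1) by (auto simp: proper_on_def)
    with ineq[of v] have "g p \<noteq> \<infinity>" by auto
    with g(1) p(1) show ?thesis by (auto simp: proper_on_def)
  qed
  fix v assume "v \<in> S"
  from ineq[OF this] fin
  show "g p + ereal (U p z + c \<bullet> p) \<le> g v + ereal (U v z + c \<bullet> v + K / 2 * (norm (v - p))\<^sup>2)"
    by (cases "g p"; cases "g v") auto
qed

section \<open>Block structure\<close>

lemma block_in_block_space [simp]: "block blk i v \<in> block_space blk i"
  by (simp add: block_def block_space_def)

lemma block_of_block_space: "v \<in> block_space blk i \<Longrightarrow> block blk i v = v"
  by (simp add: block_def block_space_def vec_eq_iff)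

lemma linear_block: "linear (block blk i)"
  by (rule linearI) (simp_all add: block_def vec_eq_iff)

lemma inner_block: "block blk i v \<bullet> w = v \<bullet> block blk i w"
  unfolding inner_vec_def by (intro sum.cong) (auto simp: block_def)

lemma sum_blocks:
  assumes "blk ` UNIV = {1..s}"
  shows "(\<Sum>i = 1..s. block blk i v) = v"
proof -
  have "blk j \<in> {1..s}" for j using assms by blast
  then have "(\<Sum>i = 1..s. if blk j = i then v $ j else 0) = v $ j" for j
    by (simp only: sum.delta'[OF finite_atLeastAtMost]) simp
  then show ?thesis
    by (simp add: vec_eq_iff block_def)
qed

lemma with_block_block [simp]: "with_block blk i (block blk i z) z = z"
  by (simp add: with_block_def block_def vec_eq_iff)

lemma block_with_block:
  "block blk j (with_block blk i v z) = (if j = i then block blk i v else block blk j z)"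
  by (auto simp: with_block_def block_def vec_eq_iff)

text \<open>
  Block \<open>i\<close> still has its old value when it is about to be updated, and \<open>partial_update_Suc\<close>
  describes its update; the other two lemmas say that a sweep leads from the old iterate to the new.
\<close>

lemma block_partial_update [simp]:
  "block blk i (partial_update blk i x' x) = block blk i x"
  by (simp add: partial_update_def block_def vec_eq_iff)

lemma partial_update_Suc:
  "partial_update blk (Suc i) x' x = with_block blk i (block blk i x') (partial_update blk i x' x)"
  by (auto simp: partial_update_def with_block_def block_def vec_eq_iff)

lemma partial_update_first:
  assumes "blk ` UNIV = {1..s}"
  shows "partial_update blk 1 x' x = x"
proof -
  have "blk j \<in> {1..s}" for j using assms by blast
  then have "blk j < 1 \<longleftrightarrow> False" for j by (metis atLeastAtMost_iff not_less)
  then show ?thesis by (simp only: partial_update_def if_False vec_lambda_eta)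
qed

lemma partial_update_last:
  assumes "blk ` UNIV = {1..s}"
  shows "partial_update blk (Suc s) x' x = x'"
proof -
  have "blk j \<le> s" for j using assms by (metis atLeastAtMost_iff rangeI)
  then show ?thesis by (auto simp: partial_update_def vec_eq_iff less_Suc_eq_le)
qed

lemma tendsto_with_block:
  assumes "(V \<longlongrightarrow> v) F" "(Z \<longlongrightarrow> z) F"
  shows "((\<lambda>k. with_block blk i (V k) (Z k)) \<longlongrightarrow> with_block blk i v z) F"
  unfolding with_block_def
proof (intro vec_tendstoI)
  fix j
  show "((\<lambda>k. (\<chi> j. if blk j = i then V k $ j else Z k $ j) $ j)
      \<longlongrightarrow> (\<chi> j. if blk j = i then v $ j else z $ j) $ j) F"
    using assms[THEN tendsto_vec_nth, of j] by (cases "blk j = i") simp_all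
qed

lemma tendsto_partial_update:
  assumes "(X' \<longlongrightarrow> x) F" "(X \<longlongrightarrow> x) F"
  shows "((\<lambda>k. partial_update blk i (X' k) (X k)) \<longlongrightarrow> x) F"
  unfolding partial_update_def
proof (intro vec_tendstoI)
  fix j
  show "((\<lambda>k. (\<chi> j. if blk j < i then X' k $ j else X k $ j) $ j) \<longlongrightarrow> x $ j) F"
    using assms[THEN tendsto_vec_nth, of j] by (cases "blk j < i") simp_all
qed

lemma block_map_with_block:
  assumes A: "\<And>i. i \<in> {1..s} \<Longrightarrow> linear (A i)" and i: "i \<in> {1..s}" and v: "v \<in> block_space blk i"
  shows "block_map blk s A (with_block blk i v z) = block_map blk s A z + A i (v - block blk i z)"
proof -
  have "block_map blk s A (with_block blk i v z)
      = A i v + (\<Sum>j\<in>{1..s} - {i}. A j (block blk j z))"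
    unfolding block_map_def sum.remove[OF finite_atLeastAtMost i] block_with_block
    by (simp add: block_of_block_space[OF v])
  moreover have "block_map blk s A z
      = A i (block blk i z) + (\<Sum>j\<in>{1..s} - {i}. A j (block blk j z))"
    unfolding block_map_def sum.remove[OF finite_atLeastAtMost i] ..
  ultimately show ?thesis
    by (simp add: linear_diff[OF A[OF i]])
qed

lemma linear_block_map:
  assumes "\<And>i. i \<in> {1..s} \<Longrightarrow> linear (A i)"
  shows "linear (block_map blk s A)"
  unfolding block_map_def
  by (intro linear_compose_sum ballI linear_compose[OF linear_block assms, unfolded o_def]) auto

lemma block_adjoint_block_map:
  assumes A: "\<And>i. i \<in> {1..s} \<Longrightarrow> linear (A i)" "\<And>v. A i v = A i (block blk i v)"
    and i: "i \<in> {1..s}"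
  shows "block blk i (adjoint (block_map blk s A) w) = adjoint (A i) w"
proof (rule vector_eq_ldot[THEN iffD1], rule allI)
  have lin: "linear (block_map blk s A)"
    by (rule linear_block_map) (rule A(1))
  fix v
  have "block blk j (block blk i v) = (if j = i then block blk i v else 0)" for j
    by (auto simp: block_def vec_eq_iff)
  then have "block_map blk s A (block blk i v) = (\<Sum>j = 1..s. if j = i then A i (block blk i v) else 0)"
    unfolding block_map_def by (intro sum.cong) (auto simp: linear_0[OF A(1)])
  also have "\<dots> = A i v"
    using i by (simp add: A(2)[of v])
  finally show "v \<bullet> block blk i (adjoint (block_map blk s A) w) = v \<bullet> adjoint (A i) w"
    by (simp add: inner_block[symmetric] adjoint_works[OF lin] adjoint_works[OF A(1)[OF i]])
qed

lemma composite_obj_with_block: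
  assumes i: "i \<in> {1..s}" and v: "v \<in> block_space blk i"
  shows "composite_obj blk s f g (with_block blk i v z) =
    ereal (f (with_block blk i v z)) + (g i v + (\<Sum>j\<in>{1..s} - {i}. g j (block blk j z)))"
  unfolding composite_obj_def sum.remove[OF finite_atLeastAtMost i] block_with_block
  by (simp add: block_of_block_space[OF v])

section \<open>Estimates for extrapolated proximal steps\<close>

text \<open>
  The objective is the sum of a convex function and a quadratic of curvature \<open>K\<close>. Comparing the
  minimizer with \<open>(1 - t) p + t w\<close>, dividing by \<open>t\<close> and letting \<open>t\<close> tend to \<open>0\<close> gains the term
  \<open>K/2 \<parallel>w - p\<parallel>\<^sup>2\<close>.
\<close>

lemma strongly_convex_argmin_gap:
  fixes G :: "'a::euclidean_space \<Rightarrow> ereal"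
  assumes conv: "ereal_convex_on S G"
    and argmin: "is_arg_min (\<lambda>v. G v + ereal (c \<bullet> v + K / 2 * (norm (v - q))\<^sup>2)) (\<lambda>v. v \<in> S) p"
    and w: "w \<in> S" and Gp: "G p = ereal a" and Gw: "G w = ereal a'"
  shows "a + (c \<bullet> p + K / 2 * (norm (p - q))\<^sup>2) + K / 2 * (norm (w - p))\<^sup>2
    \<le> a' + (c \<bullet> w + K / 2 * (norm (w - q))\<^sup>2)"
proof -
  let ?Q = "\<lambda>v. c \<bullet> v + K / 2 * (norm (v - q))\<^sup>2"
  have p: "p \<in> S" using argmin by (simp add: is_arg_min_def)
  have gap: "a + ?Q p \<le> a' + ?Q w - (1 - t) * (K / 2 * (norm (w - p))\<^sup>2)" if t: "0 < t" "t < 1" for t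
  proof -
    let ?v = "(1 - t) *\<^sub>R p + t *\<^sub>R w"
    have "?v \<in> S"
      using conv p w t by (auto simp: ereal_convex_on_def convex_def)
    have "G ?v \<le> ereal (1 - t) * G p + ereal t * G w"
      using conv p w t unfolding ereal_convex_on_def by blast
    then have G: "G ?v \<le> ereal ((1 - t) * a + t * a')"
      by (simp add: Gp Gw)
    have "ereal (a + ?Q p) \<le> G ?v + ereal (?Q ?v)"
      using argmin Gp \<open>?v \<in> S\<close> by (simp add: is_arg_min_linorder)
    also have "\<dots> \<le> ereal ((1 - t) * a + t * a') + ereal (?Q ?v)"
      by (intro add_right_mono G)
    also have "?Q ?v = (1 - t) * ?Q p + t * ?Q w - t * ((1 - t) * (K / 2 * (norm (w - p))\<^sup>2))"
      by (simp add: power2_norm_eq_inner inner_simps inner_commute algebra_simps)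
         (simp add: field_simps)
    finally have "t * (a + ?Q p) \<le> t * (a' + ?Q w - (1 - t) * (K / 2 * (norm (w - p))\<^sup>2))"
      by (simp add: field_simps)
    then show ?thesis using t by (simp only: mult_le_cancel_left_pos)
  qed
  have "((\<lambda>t. a' + ?Q w - (1 - t) * (K / 2 * (norm (w - p))\<^sup>2)) \<longlongrightarrow>
      a' + ?Q w - (1 - 0) * (K / 2 * (norm (w - p))\<^sup>2)) (at_right (0::real))"
    by (intro tendsto_intros)
  moreover have "\<forall>\<^sub>F t in at_right 0.
      a + ?Q p \<le> a' + ?Q w - (1 - t) * (K / 2 * (norm (w - p))\<^sup>2)"
    unfolding eventually_at_right_field using gap by (intro exI[of _ 1]) auto
  ultimately have "a + ?Q p \<le> a' + ?Q w - (1 - 0) * (K / 2 * (norm (w - p))\<^sup>2)"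
    by (rule tendsto_lowerbound) simp
  then show ?thesis by simp
qed

text \<open>
  The left-hand sides are the change of the quadratic penalty under a step \<open>d\<close> taken from a point
  extrapolated by \<open>e\<close>, less what the linear and proximal terms of the subproblem pay for it; the term
  \<open>a\<beta>/2 \<parallel>d\<parallel>\<^sup>2\<close> subtracted in the second one is the gain of a convex subproblem.
  The second one holds because its left-hand side is
  \<open>\<beta>/2\<close> times \<open>\<parallel>A (d - e)\<parallel>\<^sup>2 - a \<parallel>d - e\<parallel>\<^sup>2 - \<parallel>A e\<parallel>\<^sup>2 + a \<parallel>e\<parallel>\<^sup>2 - a \<parallel>d\<parallel>\<^sup>2\<close>.
\<close>

lemma extrapolated_quadratic_bounds:
  fixes A :: "'a::euclidean_space \<Rightarrow> 'b::euclidean_space"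
  assumes A: "linear A" and \<beta>: "0 < \<beta>"
  defines "a \<equiv> onorm (adjoint A \<circ> A)"
  shows "a \<le> \<kappa> \<Longrightarrow> \<beta> / 2 * (norm (A d))\<^sup>2 - \<beta> * (A e \<bullet> A d)
      - \<kappa> * \<beta> / 2 * ((norm (d - e))\<^sup>2 - (norm e)\<^sup>2)
    \<le> \<beta> * (\<kappa> + a) * norm d * norm e - (\<kappa> - a) * \<beta> / 2 * (norm d)\<^sup>2" (is "_ \<Longrightarrow> ?general")
    and "\<beta> / 2 * (norm (A d))\<^sup>2 - \<beta> * (A e \<bullet> A d)
      - a * \<beta> / 2 * ((norm (d - e))\<^sup>2 - (norm e)\<^sup>2) - a * \<beta> / 2 * (norm d)\<^sup>2
    \<le> \<beta> * a / 2 * (norm e)\<^sup>2 - \<beta> * a / 2 * (norm d)\<^sup>2" (is ?convex)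
proof -
  interpret A: linear A by fact
  have bl: "bounded_linear (adjoint A \<circ> A)"
    using A by (simp add: linear_linear linear_compose adjoint_linear)
  then have a: "0 \<le> a" unfolding a_def by (rule onorm_pos_le)
  show ?general if \<kappa>: "a \<le> \<kappa>"
  proof -
    have "- (A e \<bullet> A d) = - (e \<bullet> adjoint A (A d))"
      by (simp add: adjoint_works[OF A])
    also have "\<dots> \<le> norm e * norm (adjoint A (A d))"
      using Cauchy_Schwarz_ineq2[of e "adjoint A (A d)"] by linarith
    also have "\<dots> \<le> norm e * (a * norm d)"
      using onorm[OF bl, of d] by (intro mult_left_mono) (simp_all add: a_def)
    finally have 1: "- (A e \<bullet> A d) \<le> a * norm d * norm e" by (simp add: algebra_simps)
    have 2: "\<kappa> * (d \<bullet> e) \<le> \<kappa> * (norm d * norm e)"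
      using a \<kappa> by (intro mult_left_mono norm_cauchy_schwarz) auto
    have 3: "(norm (A d))\<^sup>2 \<le> a * (norm d)\<^sup>2"
      unfolding a_def by (rule norm_le_onorm_adjoint_comp[OF A])
    have sq: "(norm (d - e))\<^sup>2 - (norm e)\<^sup>2 = (norm d)\<^sup>2 - 2 * (d \<bullet> e)"
      by (simp add: power2_norm_eq_inner inner_simps inner_commute)
    have "(norm (A d))\<^sup>2 / 2 - A e \<bullet> A d - \<kappa> / 2 * ((norm (d - e))\<^sup>2 - (norm e)\<^sup>2)
        \<le> (\<kappa> + a) * norm d * norm e - (\<kappa> - a) / 2 * (norm d)\<^sup>2"
    proof -
      have "(\<kappa> + a) * norm d * norm e - (\<kappa> - a) / 2 * (norm d)\<^sup>2
          - ((norm (A d))\<^sup>2 / 2 - A e \<bullet> A d - \<kappa> / 2 * ((norm d)\<^sup>2 - 2 * (d \<bullet> e)))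
          = (a * norm d * norm e - - (A e \<bullet> A d))
            + (\<kappa> * (norm d * norm e) - \<kappa> * (d \<bullet> e))
            + (a * (norm d)\<^sup>2 - (norm (A d))\<^sup>2) / 2"
        by (simp add: field_simps)
      then show ?thesis unfolding sq using 1 2 3 by argo
    qed
    then have "\<beta> * ((norm (A d))\<^sup>2 / 2 - A e \<bullet> A d - \<kappa> / 2 * ((norm (d - e))\<^sup>2 - (norm e)\<^sup>2))
        \<le> \<beta> * ((\<kappa> + a) * norm d * norm e - (\<kappa> - a) / 2 * (norm d)\<^sup>2)"
      using \<beta> by simp
    then show ?thesis by (simp add: algebra_simps)
  qed
  have "(norm (A (d - e)))\<^sup>2 \<le> a * (norm (d - e))\<^sup>2"
    unfolding a_def by (rule norm_le_onorm_adjoint_comp[OF A])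
  moreover have "(norm (A (d - e)))\<^sup>2 = (norm (A d))\<^sup>2 - 2 * (A e \<bullet> A d) + (norm (A e))\<^sup>2"
    by (simp add: A.diff power2_norm_eq_inner inner_simps inner_commute)
  moreover have "0 \<le> (norm (A e))\<^sup>2" by simp
  ultimately have "(norm (A d))\<^sup>2 - 2 * (A e \<bullet> A d) \<le> a * (norm (d - e))\<^sup>2"
    by linarith
  then have "\<beta> / 2 * ((norm (A d))\<^sup>2 - 2 * (A e \<bullet> A d)) \<le> \<beta> / 2 * (a * (norm (d - e))\<^sup>2)"
    using \<beta> by (intro mult_left_mono) auto
  then show ?convex by (simp add: algebra_simps)
qed

lemma norm_add3_squared_le:
  "(p + q + r)\<^sup>2 \<le> 3 * (p\<^sup>2 + q\<^sup>2 + (r::real)\<^sup>2)"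
proof -
  have "0 \<le> (p - q)\<^sup>2 + (q - r)\<^sup>2 + (p - r)\<^sup>2" by simp
  then show ?thesis by (simp add: power2_eq_square algebra_simps)
qed

text \<open>
  Convexity of the square, with weights \<open>\<bar>1 - \<alpha>\<bar>\<close> and \<open>1 - \<bar>1 - \<alpha>\<bar>\<close>; it turns the recursion of the
  multipliers into one of squared norms without losing the contraction factor.
\<close>

lemma squared_convex_combination_le:
  fixes p q z \<alpha> :: real
  assumes \<alpha>: "0 < \<alpha>" "\<alpha> < 2" and le: "q \<le> \<bar>1 - \<alpha>\<bar> * p + \<alpha> * z" and q: "0 \<le> q"
  shows "q\<^sup>2 \<le> \<bar>1 - \<alpha>\<bar> * p\<^sup>2 + \<alpha>\<^sup>2 / (1 - \<bar>1 - \<alpha>\<bar>) * z\<^sup>2"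
proof -
  define \<theta> where "\<theta> = \<bar>1 - \<alpha>\<bar>"
  have \<theta>: "0 \<le> \<theta>" "\<theta> < 1" using \<alpha> by (auto simp: \<theta>_def)
  \<comment> \<open>Rescaled so that \<open>\<theta> p + \<alpha> z\<close> is the convex combination \<open>\<theta> p + (1 - \<theta>) w\<close>.\<close>
  define w where "w = \<alpha> * z / (1 - \<theta>)"
  have w: "\<alpha> * z = (1 - \<theta>) * w" using \<theta> by (simp add: w_def)
  have "q\<^sup>2 \<le> (\<theta> * p + (1 - \<theta>) * w)\<^sup>2"
    using le q unfolding \<theta>_def[symmetric] w by (rule power_mono)
  also have "\<dots> = \<theta> * p\<^sup>2 + (1 - \<theta>) * w\<^sup>2 - \<theta> * (1 - \<theta>) * (p - w)\<^sup>2"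
    by (simp add: power2_eq_square algebra_simps)
  also have "\<dots> \<le> \<theta> * p\<^sup>2 + (1 - \<theta>) * w\<^sup>2"
    using \<theta> by simp
  also have "(1 - \<theta>) * w\<^sup>2 = \<alpha>\<^sup>2 / (1 - \<theta>) * z\<^sup>2"
    using \<theta> by (simp add: w_def power2_eq_square)
  finally show ?thesis unfolding \<theta>_def .
qed

section \<open>The run of the algorithm\<close>

lemma gradient_augmented_terms:
  fixes A :: "'a::euclidean_space \<Rightarrow> 'c::euclidean_space" and B :: "'b::euclidean_space \<Rightarrow> 'c"
  assumes A: "linear A" and B: "linear B" and h: "GDERIV h y :> gh"
  shows "GDERIV (\<lambda>(x, y, \<omega>). h y + \<omega> \<bullet> (A x + B y - b) + \<beta> / 2 * (norm (A x + B y - b))\<^sup>2)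
      (x, y, \<omega>) :> (adjoint A (\<omega> + \<beta> *\<^sub>R (A x + B y - b)),
        gh + adjoint B (\<omega> + \<beta> *\<^sub>R (A x + B y - b)), A x + B y - b)"
proof -
  let ?r = "A x + B y - b"
  let ?R = "\<lambda>p. A (fst p) + B (fst (snd p)) - b"
  have bl: "bounded_linear A" "bounded_linear B" using A B by (simp_all add: linear_linear)
  have R: "(?R has_derivative (\<lambda>t. A (fst t) + B (fst (snd t)))) (at (x, y, \<omega>))"
    by (auto intro!: derivative_eq_intros bounded_linear.has_derivative[OF bl(1)]
        bounded_linear.has_derivative[OF bl(2)])
  have "((\<lambda>p. fst (snd p)) has_derivative (\<lambda>t. fst (snd t))) (at (x, y, \<omega>))"
    by (auto intro!: derivative_eq_intros)
  moreover have "(h has_derivative (\<lambda>t. t \<bullet> gh)) (at (fst (snd (x, y, \<omega>))))"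
    using h by (simp add: gderiv_def)
  ultimately have H: "((\<lambda>p. h (fst (snd p))) has_derivative (\<lambda>t. fst (snd t) \<bullet> gh)) (at (x, y, \<omega>))"
    by (rule has_derivative_compose)
  have W: "((\<lambda>p. snd (snd p)) has_derivative (\<lambda>t. snd (snd t))) (at (x, y, \<omega>))"
    by (auto intro!: derivative_eq_intros)
  have "((\<lambda>p. h (fst (snd p)) + snd (snd p) \<bullet> ?R p + \<beta> / 2 * (?R p \<bullet> ?R p)) has_derivative
      (\<lambda>t. fst (snd t) \<bullet> gh + (\<omega> \<bullet> (A (fst t) + B (fst (snd t))) + snd (snd t) \<bullet> ?r)
        + \<beta> / 2 * (?r \<bullet> (A (fst t) + B (fst (snd t))) + (A (fst t) + B (fst (snd t))) \<bullet> ?r)))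
      (at (x, y, \<omega>))"
    using has_derivative_add[OF has_derivative_add[OF H has_derivative_inner[OF W R]]
        has_derivative_mult_right[OF has_derivative_inner[OF R R], of "\<beta> / 2"]]
    by simp
  moreover have "(\<lambda>t. fst (snd t) \<bullet> gh + (\<omega> \<bullet> (A (fst t) + B (fst (snd t))) + snd (snd t) \<bullet> ?r)
        + \<beta> / 2 * (?r \<bullet> (A (fst t) + B (fst (snd t))) + (A (fst t) + B (fst (snd t))) \<bullet> ?r))
      = (\<lambda>t. t \<bullet> (adjoint A (\<omega> + \<beta> *\<^sub>R ?r), gh + adjoint B (\<omega> + \<beta> *\<^sub>R ?r), ?r))"
  proof
    fix t :: "'a \<times> 'b \<times> 'c"
    obtain t1 t2 t3 where t: "t = (t1, t2, t3)" by (cases t)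
    define r where "r = ?r"
    have "t \<bullet> (adjoint A (\<omega> + \<beta> *\<^sub>R r), gh + adjoint B (\<omega> + \<beta> *\<^sub>R r), r)
        = A t1 \<bullet> (\<omega> + \<beta> *\<^sub>R r) + (t2 \<bullet> gh + B t2 \<bullet> (\<omega> + \<beta> *\<^sub>R r)) + t3 \<bullet> r"
      by (simp add: t inner_add_right adjoint_works[OF A] adjoint_works[OF B])
    also have "\<dots> = t2 \<bullet> gh + (\<omega> \<bullet> (A t1 + B t2) + t3 \<bullet> r)
        + \<beta> / 2 * (r \<bullet> (A t1 + B t2) + (A t1 + B t2) \<bullet> r)"
      by (simp add: inner_add_left inner_add_right inner_commute[of \<omega>] inner_commute[of r]
          field_simps)
    finally show "fst (snd t) \<bullet> gh + (\<omega> \<bullet> (A (fst t) + B (fst (snd t))) + snd (snd t) \<bullet> ?r)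
        + \<beta> / 2 * (?r \<bullet> (A (fst t) + B (fst (snd t))) + (A (fst t) + B (fst (snd t))) \<bullet> ?r)
      = t \<bullet> (adjoint A (\<omega> + \<beta> *\<^sub>R ?r), gh + adjoint B (\<omega> + \<beta> *\<^sub>R ?r), ?r)"
      unfolding r_def by (simp add: t)
  qed
  moreover have "(\<lambda>p. h (fst (snd p)) + snd (snd p) \<bullet> ?R p + \<beta> / 2 * (?R p \<bullet> ?R p))
      = (\<lambda>(x, y, \<omega>). h y + \<omega> \<bullet> (A x + B y - b) + \<beta> / 2 * (norm (A x + B y - b))\<^sup>2)"
    by (auto simp: power2_norm_eq_inner)
  ultimately show ?thesis
    unfolding gderiv_def by simp
qed

text \<open>
  The problem data, the parameter conditions, and a run of the algorithm whose multipliers stay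
  bounded.
\<close>

locale iADMM_run =
  fixes blk :: "'n::finite \<Rightarrow> nat" and s :: nat
    and f :: "real^'n \<Rightarrow> real" and g :: "nat \<Rightarrow> real^'n \<Rightarrow> ereal"
    and h :: "real^'q::finite \<Rightarrow> real" and gh :: "real^'q \<Rightarrow> real^'q" and L\<^sub>h :: real
    and A :: "nat \<Rightarrow> real^'n \<Rightarrow> real^'m::finite" and B :: "real^'q \<Rightarrow> real^'m" and b :: "real^'m"
    and u :: "nat \<Rightarrow> real^'n \<Rightarrow> real^'n \<Rightarrow> real"
    and F :: "real^'n \<Rightarrow> ereal"
    and \<alpha> \<beta> \<sigma>\<^sub>B \<alpha>\<^sub>2 \<mu> \<eta>\<^sub>y \<nu>\<^sub>y C\<^sub>x C\<^sub>y C\<^sub>1 C\<^sub>2 :: real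
    and \<kappa> \<nu> \<eta> \<delta> \<delta>bar \<gamma>\<^sub>y :: "nat \<Rightarrow> real" and \<zeta> \<gamma> :: "nat \<Rightarrow> nat \<Rightarrow> real"
    and x :: "nat \<Rightarrow> real^'n" and y :: "nat \<Rightarrow> real^'q" and \<omega> :: "nat \<Rightarrow> real^'m"
  assumes blk: "blk ` UNIV = {1..s}"
    and A: "\<And>i. i \<in> {1..s} \<Longrightarrow> linear (A i)"
           "\<And>i v. i \<in> {1..s} \<Longrightarrow> A i v = A i (block blk i v)"
    and B: "linear B"
    and g: "\<And>i. i \<in> {1..s} \<Longrightarrow> proper_on (block_space blk i) (g i)"
           "\<And>i. i \<in> {1..s} \<Longrightarrow> lsc_on (block_space blk i) (g i)"
    and F: "F = composite_obj blk s f g"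
    and bdd_below: "\<exists>c::real. \<forall>z w. ereal c \<le> F z + ereal (h w)"
    and h: "\<And>w. GDERIV h w :> gh w" "L\<^sub>h-lipschitz_on UNIV gh"
    and \<sigma>\<^sub>B: "\<sigma>\<^sub>B = lambda_min (B \<circ> adjoint B)" "\<sigma>\<^sub>B > 0"
    and u: "\<And>i. i \<in> {1..s} \<Longrightarrow> block_surrogate blk i f (u i)"
           "\<And>i. i \<in> {1..s} \<Longrightarrow> continuous_on (block_space blk i \<times> UNIV) (\<lambda>(v, z). u i v z)"
           "\<And>i. i \<in> {1..s} \<Longrightarrow> surrogate_error_bound blk i f (u i)"
    and \<alpha>: "0 < \<alpha>" "\<alpha> < 2"
    and \<beta>: "\<beta> > 0"
    and \<alpha>\<^sub>2: "\<alpha>\<^sub>2 = 3 * \<alpha> / (\<sigma>\<^sub>B * (1 - \<bar>1 - \<alpha>\<bar>)\<^sup>2)"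
    and \<delta>bar: "\<And>k. \<delta>bar k = (if \<forall>l. \<delta> l = 0 then 2 else 4 * (1 + \<delta> k)\<^sup>2)"
    and \<nu>: "\<And>i. i \<in> {1..s} \<Longrightarrow> if \<forall>k. \<zeta> i k = 0 then \<nu> i = 0 else 0 < \<nu> i \<and> \<nu> i < 1"
    and \<nu>\<^sub>y: "if \<forall>k. \<delta> k = 0 then \<nu>\<^sub>y = 0 else 0 < \<nu>\<^sub>y \<and> \<nu>\<^sub>y < 1"
    and \<kappa>_\<eta>_\<gamma>: "\<And>i. i \<in> {1..s} \<Longrightarrow>
           (let a = onorm (adjoint (A i) \<circ> A i) in
              (\<kappa> i > a \<and>
               \<eta> i = (1 - \<nu> i) * (\<kappa> i - a) * \<beta> / 2 \<and>
               (\<forall>k. \<gamma> i k = (\<beta> * \<zeta> i k * (\<kappa> i + a))\<^sup>2 / (2 * \<nu> i * (\<kappa> i - a) * \<beta>)))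
            \<or> ((\<forall>z. ereal_convex_on (block_space blk i) (\<lambda>v. ereal (u i v z) + g i v)) \<and>
               \<kappa> i = a \<and>
               \<eta> i = \<beta> * a / 2 \<and>
               (\<forall>k. \<gamma> i k = \<beta> * a * (\<zeta> i k)\<^sup>2 / 2)))"
    and \<eta>\<^sub>y: "\<eta>\<^sub>y = (if convex_on UNIV h then L\<^sub>h / 2
                 else (1 - \<nu>\<^sub>y) * (\<beta> * lambda_min (adjoint B \<circ> B) + L\<^sub>h) / 2)"
    and \<gamma>\<^sub>y: "\<And>k. \<gamma>\<^sub>y k = (if convex_on UNIV h then L\<^sub>h * (\<delta> k)\<^sup>2 / 2
                 else 2 * L\<^sub>h\<^sup>2 * (\<delta> k)\<^sup>2 / (\<nu>\<^sub>y * (\<beta> * lambda_min (adjoint B \<circ> B) + L\<^sub>h)))"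
    and seq: "iADMM_sequence blk s u g gh L\<^sub>h A B b \<alpha> \<beta> \<kappa> \<zeta> \<delta> x y \<omega>"
    and \<mu>: "\<mu> = \<eta>\<^sub>y - \<alpha>\<^sub>2 * L\<^sub>h\<^sup>2 / \<beta>" "\<mu> > 0"
    and \<eta>: "\<And>i. i \<in> {1..s} \<Longrightarrow> \<eta> i > 0"
    and C: "0 < C\<^sub>x" "C\<^sub>x < 1" "0 < C\<^sub>y" "C\<^sub>y < 1"
    and C\<^sub>1\<^sub>2: "if \<forall>k. \<delta> k = 0 then C\<^sub>1 = C\<^sub>y \<and> C\<^sub>2 = 0
              else 0 < C\<^sub>1 \<and> C\<^sub>1 < C\<^sub>y \<and> C\<^sub>2 = C\<^sub>y - C\<^sub>1"
    and cond_x: "\<And>k i. k \<ge> 1 \<Longrightarrow> i \<in> {1..s} \<Longrightarrow> \<gamma> i k \<le> C\<^sub>x * \<eta> i"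
    and cond_y: "\<And>k. k \<ge> 1 \<Longrightarrow> 4 * \<alpha>\<^sub>2 * L\<^sub>h\<^sup>2 * (\<delta> (k - 1))\<^sup>2 / \<beta> \<le> C\<^sub>2 * \<mu>"
                "\<And>k. k \<ge> 1 \<Longrightarrow> \<alpha>\<^sub>2 * L\<^sub>h\<^sup>2 * \<delta>bar k / \<beta> + \<gamma>\<^sub>y k \<le> C\<^sub>1 * \<mu>"
    and bounded_\<omega>: "bounded (range \<omega>)"
begin

definition residual :: "nat \<Rightarrow> real^'m" where
  "residual k = block_map blk s A (x k) + B (y k) - b"

definition partial_x :: "nat \<Rightarrow> nat \<Rightarrow> real^'n" where
  "partial_x i k = partial_update blk i (x (Suc k)) (x k)"

definition xbar :: "nat \<Rightarrow> nat \<Rightarrow> real^'n" where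
  "xbar i k = block blk i (x k + \<zeta> i k *\<^sub>R (x k - x (k - 1)))"

definition linear_coef :: "nat \<Rightarrow> nat \<Rightarrow> real^'n" where
  "linear_coef i k = adjoint (A i)
     (\<omega> k + \<beta> *\<^sub>R (block_map blk s A (with_block blk i (xbar i k) (partial_x i k)) + B (y k) - b))"

definition yhat :: "nat \<Rightarrow> real^'q" where
  "yhat k = y k + \<delta> k *\<^sub>R (y k - y (k - 1))"

definition dx :: "nat \<Rightarrow> nat \<Rightarrow> real" where
  "dx i k = norm (block blk i (x k - x (k - 1)))"

definition dy :: "nat \<Rightarrow> real" where
  "dy k = norm (y k - y (k - 1))"

definition dB\<omega> :: "nat \<Rightarrow> real" where
  "dB\<omega> k = norm (adjoint B (\<omega> k - \<omega> (k - 1)))"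

text \<open>
  The gradient at \<open>y\<^sup>k\<^sup>+\<^sup>1\<close> of the quadratic model of \<open>h\<close> around \<open>yhat k\<close> that the \<open>y\<close> update
  uses.
\<close>

definition h_model_grad :: "nat \<Rightarrow> real^'q" where
  "h_model_grad k = gh (yhat k) + L\<^sub>h *\<^sub>R (y (Suc k) - yhat k)"

text \<open>
  Meaningful from \<open>k = 1\<close> on: the starting point may lie outside the domain of \<open>g i\<close>, but every
  block of a later iterate minimizes a proper function. Hence the estimates for a whole iteration
  start at \<open>k = 1\<close>.
\<close>

definition g_value :: "nat \<Rightarrow> nat \<Rightarrow> real" where
  "g_value i k = real_of_ereal (g i (block blk i (x k)))"

definition lagrangian_value :: "nat \<Rightarrow> real" where
  "lagrangian_value k = f (x k) + (\<Sum>i = 1..s. g_value i k) + h (y k)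
     + \<omega> k \<bullet> residual k + \<beta> / 2 * (norm (residual k))\<^sup>2"

lemma x_update:
  assumes "i \<in> {1..s}"
  shows "is_arg_min
    (\<lambda>v. ereal (u i v (partial_x i k)) + g i v
       + ereal (linear_coef i k \<bullet> v + \<kappa> i * \<beta> / 2 * (norm (v - xbar i k))\<^sup>2))
    (\<lambda>v. v \<in> block_space blk i) (block blk i (x (Suc k)))"
  using seq assms unfolding iADMM_sequence_def Let_def partial_x_def xbar_def linear_coef_def by blast

lemma y_update:
  "is_arg_min (\<lambda>w. (adjoint B (\<omega> k) + gh (yhat k)) \<bullet> w
      + \<beta> / 2 * (norm ((block_map blk s A (x (Suc k)) - b) + B w))\<^sup>2
      + L\<^sub>h / 2 * (norm (w - yhat k))\<^sup>2) (\<lambda>w. True) (y (Suc k))"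
proof -
  have "block_map blk s A (x (Suc k)) - b + B w = block_map blk s A (x (Suc k)) + B w - b" for w
    by simp
  then show ?thesis
    using seq unfolding iADMM_sequence_def Let_def yhat_def by (simp only:)
qed

lemma \<omega>_update: "\<omega> (Suc k) = \<omega> k + (\<alpha> * \<beta>) *\<^sub>R residual (Suc k)"
  using seq unfolding iADMM_sequence_def residual_def by blast

lemma L\<^sub>h_nonneg: "0 \<le> L\<^sub>h"
  using h(2) by (rule lipschitz_on_nonneg)

lemma relaxation_pos: "0 < 1 - \<bar>1 - \<alpha>\<bar>"
  using \<alpha> by auto

lemma \<alpha>\<^sub>2_pos: "0 < \<alpha>\<^sub>2"
  unfolding \<alpha>\<^sub>2 using \<alpha> \<sigma>\<^sub>B relaxation_pos by simp

lemma \<eta>\<^sub>y_pos: "0 < \<eta>\<^sub>y"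
proof -
  have "0 \<le> \<alpha>\<^sub>2 * L\<^sub>h\<^sup>2 / \<beta>" using \<alpha>\<^sub>2_pos \<beta> by simp
  with \<mu> show ?thesis by linarith
qed

text \<open>
  In the nonconvex case the denominator of \<open>\<gamma>\<^sub>y\<close> is nonnegative because \<open>\<eta>\<^sub>y\<close> is positive, which
  in turn follows from \<open>\<mu> > 0\<close>.
\<close>

lemma \<gamma>\<^sub>y_nonneg: "0 \<le> \<gamma>\<^sub>y k"
proof (cases "convex_on UNIV h")
  case False
  have \<nu>: "0 \<le> \<nu>\<^sub>y" "\<nu>\<^sub>y < 1" using \<nu>\<^sub>y by (auto split: if_splits)
  with \<eta>\<^sub>y_pos False have "0 < \<beta> * lambda_min (adjoint B \<circ> B) + L\<^sub>h"
    unfolding \<eta>\<^sub>y by (simp add: zero_less_mult_iff)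
  with \<nu> False show ?thesis by (simp add: \<gamma>\<^sub>y)
qed (simp add: \<gamma>\<^sub>y L\<^sub>h_nonneg)

lemma C\<^sub>1\<^sub>2_nonneg: "0 \<le> C\<^sub>1" "0 \<le> C\<^sub>2" "C\<^sub>1 + C\<^sub>2 = C\<^sub>y"
proof -
  have "C\<^sub>1 = C\<^sub>y \<and> C\<^sub>2 = 0 \<or> 0 < C\<^sub>1 \<and> C\<^sub>1 < C\<^sub>y \<and> C\<^sub>2 = C\<^sub>y - C\<^sub>1"
    using C\<^sub>1\<^sub>2 by presburger
  then show "0 \<le> C\<^sub>1" "0 \<le> C\<^sub>2" "C\<^sub>1 + C\<^sub>2 = C\<^sub>y"
    using C by linarith+
qed

lemma g_not_MInf: "i \<in> {1..s} \<Longrightarrow> g i (block blk i z) \<noteq> -\<infinity>"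
  using g(1) by (simp add: proper_on_def)

lemma g_finite:
  assumes i: "i \<in> {1..s}"
  shows "g i (block blk i (x (Suc k))) = ereal (g_value i (Suc k))"
proof -
  obtain v where v: "v \<in> block_space blk i" "g i v \<noteq> \<infinity>"
    using g(1)[OF i] by (auto simp: proper_on_def)
  let ?\<psi> = "\<lambda>v. ereal (u i v (partial_x i k)) + g i v
       + ereal (linear_coef i k \<bullet> v + \<kappa> i * \<beta> / 2 * (norm (v - xbar i k))\<^sup>2)"
  have "?\<psi> (block blk i (x (Suc k))) \<le> ?\<psi> v"
    using x_update[OF i, of k] v(1) unfolding is_arg_min_linorder by blast
  with v(2) have "g i (block blk i (x (Suc k))) \<noteq> \<infinity>"
    using g(1)[OF i] v by (cases "g i v") (auto simp: proper_on_def)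
  with g_not_MInf[OF i] show ?thesis
    unfolding g_value_def by (cases "g i (block blk i (x (Suc k)))") auto
qed

section \<open>Descent of the augmented Lagrangian\<close>

text \<open>
  Minimality of the new block against the old one replaces \<open>f\<close> by its surrogate at no loss, since
  the two agree at the old point and the surrogate dominates at the new one. What remains is the
  quadratic estimate for extrapolated steps. In the general case Young's inequality with the weight
  \<open>\<nu>\<^sub>i (\<kappa>\<^sub>i - a) \<beta>\<close> separates its mixed term, which explains the form of \<open>\<eta>\<^sub>i\<close> and \<open>\<gamma>\<^sub>i\<close>; in the
  convex case the surplus from strong convexity absorbs the mixed term.
\<close>

lemma block_descent:
  assumes i: "i \<in> {1..s}" and k: "1 \<le> k"
  defines "P \<equiv> \<lambda>z. f z + \<omega> k \<bullet> (block_map blk s A z + B (y k) - b)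
      + \<beta> / 2 * (norm (block_map blk s A z + B (y k) - b))\<^sup>2"
  shows "P (partial_x (Suc i) k) + g_value i (Suc k) + \<eta> i * (dx i (Suc k))\<^sup>2
    \<le> P (partial_x i k) + g_value i k + \<gamma> i k * (dx i k)\<^sup>2"
proof -
  interpret Ai: linear "A i" using A(1)[OF i] .
  define a where "a = onorm (adjoint (A i) \<circ> A i)"
  define z where "z = partial_x i k"
  define p where "p = block blk i (x k)"
  define p' where "p' = block blk i (x (Suc k))"
  define d where "d = p' - p"
  define e where "e = xbar i k - p"
  define r where "r = block_map blk s A z + B (y k) - b"
  have pz: "block blk i z = p" by (simp add: z_def partial_x_def p_def)
  have spaces: "p \<in> block_space blk i" "p' \<in> block_space blk i" "xbar i k \<in> block_space blk i"
    by (simp_all add: p_def p'_def xbar_def)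
  have z': "partial_x (Suc i) k = with_block blk i p' z"
    by (simp add: partial_x_def partial_update_Suc p'_def z_def)
  have move: "block_map blk s A (with_block blk i v z) = block_map blk s A z + A i (v - p)"
    if "v \<in> block_space blk i" for v
    using block_map_with_block[of s A, OF A(1) i that, of z] by (simp add: pz)
  have norm_d: "norm d = dx i (Suc k)"
    by (simp add: d_def p_def p'_def dx_def linear_diff[OF linear_block])
  have e: "e = \<zeta> i k *\<^sub>R block blk i (x k - x (k - 1))"
    by (simp add: e_def xbar_def p_def linear_add[OF linear_block] linear_scale[OF linear_block])
  then have norm_e: "norm e = \<bar>\<zeta> i k\<bar> * dx i k" by (simp add: dx_def)
  have linear_coef: "linear_coef i k = adjoint (A i) (\<omega> k + \<beta> *\<^sub>R (r + A i e))"
    unfolding linear_coef_def z_def[symmetric] move[OF spaces(3)]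
    by (simp add: r_def e_def algebra_simps)
  have coef_d: "linear_coef i k \<bullet> p' - linear_coef i k \<bullet> p = (\<omega> k + \<beta> *\<^sub>R r) \<bullet> A i d + \<beta> * (A i e \<bullet> A i d)"
    unfolding inner_diff_right[symmetric] d_def[symmetric] linear_coef
    by (simp add: adjoint_clauses[OF A(1)[OF i]] inner_simps algebra_simps)
  have u_p: "u i p z = f z"
    using u(1)[OF i] pz by (auto simp: block_surrogate_def)
  have u_p': "f (partial_x (Suc i) k) \<le> u i p' z"
    using u(1)[OF i] spaces(2) unfolding z' by (simp add: block_surrogate_def)
  have gp: "g i p = ereal (g_value i k)"
    using g_finite[OF i, of "k - 1"] k by (simp add: p_def)
  have gp': "g i p' = ereal (g_value i (Suc k))"
    using g_finite[OF i] by (simp add: p'_def)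
  have shifts: "norm (p' - xbar i k) = norm (d - e)" "norm (p - xbar i k) = norm e"
    by (simp_all add: d_def e_def norm_minus_commute)
  have P: "P (partial_x (Suc i) k) - P z = f (partial_x (Suc i) k) - f z
      + (\<omega> k + \<beta> *\<^sub>R r) \<bullet> A i d + \<beta> / 2 * (norm (A i d))\<^sup>2"
  proof -
    have "block_map blk s A (partial_x (Suc i) k) + B (y k) - b = r + A i d"
      unfolding z' move[OF spaces(2)] by (simp add: r_def d_def)
    then have "P (partial_x (Suc i) k)
        = f (partial_x (Suc i) k) + \<omega> k \<bullet> (r + A i d) + \<beta> / 2 * (norm (r + A i d))\<^sup>2"
      by (simp add: P_def)
    moreover have "P z = f z + \<omega> k \<bullet> r + \<beta> / 2 * (norm r)\<^sup>2"
      by (simp add: P_def r_def)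
    ultimately show ?thesis
      by (simp only: power2_norm_eq_inner) (simp add: inner_simps inner_commute field_simps)
  qed
  \<comment> \<open>The number \<open>\<tau>\<close> is the surplus of minimality: \<open>0\<close> in general, \<open>\<kappa>\<^sub>i\<beta>/2 \<parallel>d\<parallel>\<^sup>2\<close> in the convex case.\<close>
  have descent: "P (partial_x (Suc i) k) + g_value i (Suc k)
      \<le> P z + g_value i k + (\<beta> / 2 * (norm (A i d))\<^sup>2 - \<beta> * (A i e \<bullet> A i d)
        - \<kappa> i * \<beta> / 2 * ((norm (d - e))\<^sup>2 - (norm e)\<^sup>2) - \<tau>)"
    if "u i p' z + g_value i (Suc k) + (linear_coef i k \<bullet> p' + \<kappa> i * \<beta> / 2 * (norm (p' - xbar i k))\<^sup>2) + \<tau>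
      \<le> u i p z + g_value i k + (linear_coef i k \<bullet> p + \<kappa> i * \<beta> / 2 * (norm (p - xbar i k))\<^sup>2)" for \<tau>
  proof -
    have "\<kappa> i * \<beta> / 2 * ((norm (d - e))\<^sup>2 - (norm e)\<^sup>2)
        = \<kappa> i * \<beta> / 2 * (norm (d - e))\<^sup>2 - \<kappa> i * \<beta> / 2 * (norm e)\<^sup>2"
      by (simp add: algebra_simps)
    with that P coef_d u_p u_p' show ?thesis unfolding shifts by argo
  qed
  note bounds = extrapolated_quadratic_bounds[OF A(1)[OF i] \<beta>, folded a_def]
  from \<kappa>_\<eta>_\<gamma>[OF i] consider
    (general) "\<kappa> i > a" "\<eta> i = (1 - \<nu> i) * (\<kappa> i - a) * \<beta> / 2"
      "\<gamma> i k = (\<beta> * \<zeta> i k * (\<kappa> i + a))\<^sup>2 / (2 * \<nu> i * (\<kappa> i - a) * \<beta>)"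
  | (convex) "ereal_convex_on (block_space blk i) (\<lambda>v. ereal (u i v z) + g i v)"
      "\<kappa> i = a" "\<eta> i = \<beta> * a / 2" "\<gamma> i k = \<beta> * a * (\<zeta> i k)\<^sup>2 / 2"
    unfolding Let_def a_def[symmetric] by auto
  then show ?thesis
  proof cases
    case general
    have "ereal (u i p' z) + g i p' + ereal (linear_coef i k \<bullet> p' + \<kappa> i * \<beta> / 2 * (norm (p' - xbar i k))\<^sup>2)
      \<le> ereal (u i p z) + g i p + ereal (linear_coef i k \<bullet> p + \<kappa> i * \<beta> / 2 * (norm (p - xbar i k))\<^sup>2)"
      using x_update[OF i, of k] spaces unfolding is_arg_min_linorder z_def[symmetric] p'_def[symmetric]
      by blast
    then have "P (partial_x (Suc i) k) + g_value i (Suc k)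
      \<le> P z + g_value i k + (\<beta> / 2 * (norm (A i d))\<^sup>2 - \<beta> * (A i e \<bullet> A i d)
        - \<kappa> i * \<beta> / 2 * ((norm (d - e))\<^sup>2 - (norm e)\<^sup>2) - 0)"
      by (intro descent) (simp add: gp gp')
    moreover have "\<beta> / 2 * (norm (A i d))\<^sup>2 - \<beta> * (A i e \<bullet> A i d)
        - \<kappa> i * \<beta> / 2 * ((norm (d - e))\<^sup>2 - (norm e)\<^sup>2)
      \<le> \<beta> * (\<kappa> i + a) * norm d * norm e - (\<kappa> i - a) * \<beta> / 2 * (norm d)\<^sup>2"
      using general by (intro bounds) simp
    moreover have "\<beta> * (\<kappa> i + a) * norm d * norm e
      \<le> \<nu> i * (\<kappa> i - a) * \<beta> / 2 * (norm d)\<^sup>2 + \<gamma> i k * (dx i k)\<^sup>2"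
    proof (cases "\<forall>k. \<zeta> i k = 0")
      \<comment> \<open>Without extrapolation \<open>\<nu> i = 0\<close>, and \<open>\<gamma> i k = 0\<close> as a quotient by zero.\<close>
      case True
      then show ?thesis using \<nu>[OF i] by (simp add: norm_e general)
    next
      case False
      then have "0 < \<nu> i * (\<kappa> i - a) * \<beta>"
        using \<nu>[OF i] general \<beta> by simp
      then have "\<beta> * (\<kappa> i + a) * \<bar>\<zeta> i k\<bar> * norm d * dx i k
        \<le> \<nu> i * (\<kappa> i - a) * \<beta> / 2 * (norm d)\<^sup>2
          + (\<beta> * (\<kappa> i + a) * \<bar>\<zeta> i k\<bar>)\<^sup>2 / (2 * (\<nu> i * (\<kappa> i - a) * \<beta>)) * (dx i k)\<^sup>2"
        by (rule young_product)
      also have "(\<beta> * (\<kappa> i + a) * \<bar>\<zeta> i k\<bar>)\<^sup>2 / (2 * (\<nu> i * (\<kappa> i - a) * \<beta>)) = \<gamma> i k"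
      proof -
        have "(\<beta> * (\<kappa> i + a) * \<bar>\<zeta> i k\<bar>)\<^sup>2 = (\<beta> * \<zeta> i k * (\<kappa> i + a))\<^sup>2"
          by (simp only: power_mult_distrib power2_abs mult_ac)
        then show ?thesis by (simp add: general(3) mult.assoc)
      qed
      finally show ?thesis by (simp add: norm_e algebra_simps)
    qed
    moreover have "\<eta> i * (norm d)\<^sup>2
      = (\<kappa> i - a) * \<beta> / 2 * (norm d)\<^sup>2 - \<nu> i * (\<kappa> i - a) * \<beta> / 2 * (norm d)\<^sup>2"
      by (simp add: general field_simps)
    ultimately show ?thesis
      unfolding z_def[symmetric] norm_d by argo
  next
    case convex
    have "u i p' z + g_value i (Suc k) + (linear_coef i k \<bullet> p' + \<kappa> i * \<beta> / 2 * (norm (p' - xbar i k))\<^sup>2)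
        + \<kappa> i * \<beta> / 2 * (norm (p - p'))\<^sup>2
      \<le> u i p z + g_value i k + (linear_coef i k \<bullet> p + \<kappa> i * \<beta> / 2 * (norm (p - xbar i k))\<^sup>2)"
      using x_update[OF i, of k] unfolding z_def[symmetric] p'_def[symmetric]
      by (rule strongly_convex_argmin_gap[OF convex(1)]) (simp_all add: spaces gp gp')
    then have "P (partial_x (Suc i) k) + g_value i (Suc k)
      \<le> P z + g_value i k + (\<beta> / 2 * (norm (A i d))\<^sup>2 - \<beta> * (A i e \<bullet> A i d)
        - \<kappa> i * \<beta> / 2 * ((norm (d - e))\<^sup>2 - (norm e)\<^sup>2) - \<kappa> i * \<beta> / 2 * (norm (p - p'))\<^sup>2)"
      by (rule descent)
    moreover have "norm (p - p') = norm d" by (simp add: d_def norm_minus_commute)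
    ultimately have "P (partial_x (Suc i) k) + g_value i (Suc k)
      \<le> P z + g_value i k + (\<beta> / 2 * (norm (A i d))\<^sup>2 - \<beta> * (A i e \<bullet> A i d)
        - a * \<beta> / 2 * ((norm (d - e))\<^sup>2 - (norm e)\<^sup>2) - a * \<beta> / 2 * (norm d)\<^sup>2)"
      by (simp only: convex(2))
    moreover note bounds(2)[of d e]
    moreover have "\<beta> * a / 2 * (norm e)\<^sup>2 = \<gamma> i k * (dx i k)\<^sup>2"
      by (simp add: convex norm_e power_mult_distrib)
    ultimately show ?thesis
      unfolding z_def[symmetric] norm_d[symmetric] convex(2,3) by argo
  qed
qed

lemma sweep_descent:
  assumes k: "1 \<le> k"
  defines "P \<equiv> \<lambda>z. f z + \<omega> k \<bullet> (block_map blk s A z + B (y k) - b)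
      + \<beta> / 2 * (norm (block_map blk s A z + B (y k) - b))\<^sup>2"
  shows "P (x (Suc k)) + (\<Sum>i = 1..s. g_value i (Suc k)) + (\<Sum>i = 1..s. \<eta> i * (dx i (Suc k))\<^sup>2)
    \<le> P (x k) + (\<Sum>i = 1..s. g_value i k) + (\<Sum>i = 1..s. \<gamma> i k * (dx i k)\<^sup>2)"
proof -
  have "(\<Sum>i = 1..s. P (partial_x (Suc i) k) - P (partial_x i k)) = P (partial_x (Suc s) k) - P (partial_x 1 k)"
    by (rule sum_Suc_diff) simp
  moreover have "partial_x (Suc s) k = x (Suc k)" "partial_x 1 k = x k"
    unfolding partial_x_def by (rule partial_update_last[OF blk] partial_update_first[OF blk])+
  moreover have "(\<Sum>i = 1..s. (P (partial_x (Suc i) k) - P (partial_x i k)) + g_value i (Suc k) + \<eta> i * (dx i (Suc k))\<^sup>2)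
    \<le> (\<Sum>i = 1..s. g_value i k + \<gamma> i k * (dx i k)\<^sup>2)"
  proof (rule sum_mono)
    fix i assume "i \<in> {1..s}"
    from block_descent[OF this k]
    show "(P (partial_x (Suc i) k) - P (partial_x i k)) + g_value i (Suc k) + \<eta> i * (dx i (Suc k))\<^sup>2
      \<le> g_value i k + \<gamma> i k * (dx i k)\<^sup>2"
      unfolding P_def by argo
  qed
  ultimately show ?thesis
    unfolding sum.distrib by simp
qed

text \<open>
  The \<open>y\<close> subproblem is an exactly solvable quadratic, so minimality is an identity (\<open>model\<close> in the
  proof). In the convex case \<open>h\<close> is compared with its linearization at the extrapolated point, from
  above at the new iterate and from below at the old one; otherwise it is expanded at the old
  iterate and the change of gradient costs \<open>2 L\<^sub>h \<bar>\<delta>\<^sub>k\<bar>\<close> times the product of the two steps.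
\<close>

lemma y_descent:
  fixes k :: nat
  defines "R \<equiv> \<lambda>w. block_map blk s A (x (Suc k)) + B w - b"
  shows "h (y (Suc k)) + \<omega> k \<bullet> R (y (Suc k)) + \<beta> / 2 * (norm (R (y (Suc k))))\<^sup>2 + \<eta>\<^sub>y * (dy (Suc k))\<^sup>2
    \<le> h (y k) + \<omega> k \<bullet> R (y k) + \<beta> / 2 * (norm (R (y k)))\<^sup>2 + \<gamma>\<^sub>y k * (dy k)\<^sup>2"
proof -
  interpret B: linear B by (rule B)
  define d where "d = y (Suc k) - y k"
  define e where "e = yhat k - y k"
  have norm_d: "norm d = dy (Suc k)" by (simp add: d_def dy_def)
  have norm_e: "norm e = \<bar>\<delta> k\<bar> * dy k" by (simp add: e_def yhat_def dy_def)
  have shifts: "y (Suc k) - yhat k = d - e" "y k - yhat k = - e" "y k - y (Suc k) = - d"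
    by (simp_all add: d_def e_def)
  have R: "block_map blk s A (x (Suc k)) - b + B w = R w" for w by (simp add: R_def)
  have inner: "(adjoint B (\<omega> k) + gh (yhat k)) \<bullet> y k
      = (adjoint B (\<omega> k) + gh (yhat k)) \<bullet> y (Suc k)
        - (\<omega> k \<bullet> R (y (Suc k)) - \<omega> k \<bullet> R (y k)) - gh (yhat k) \<bullet> d"
    by (simp add: R_def d_def inner_simps adjoint_clauses[OF B])
  have model: "\<omega> k \<bullet> R (y (Suc k)) + \<beta> / 2 * (norm (R (y (Suc k))))\<^sup>2 + gh (yhat k) \<bullet> d
      + L\<^sub>h / 2 * (norm (d - e))\<^sup>2 + \<beta> / 2 * (norm (B d))\<^sup>2 + L\<^sub>h / 2 * (norm d)\<^sup>2
      = \<omega> k \<bullet> R (y k) + \<beta> / 2 * (norm (R (y k)))\<^sup>2 + L\<^sub>h / 2 * (norm e)\<^sup>2"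
    using regularized_least_squares_argmin(2)[OF B y_update[of k], where w = "y k"] inner
    unfolding R shifts B.neg norm_minus_cancel by argo
  have sq: "L\<^sub>h / 2 * (norm (d - e))\<^sup>2 = L\<^sub>h / 2 * (norm d)\<^sup>2 - L\<^sub>h * (d \<bullet> e) + L\<^sub>h / 2 * (norm e)\<^sup>2"
    by (simp add: power2_norm_eq_inner inner_simps inner_commute field_simps)
  show ?thesis
  proof (cases "convex_on UNIV h")
    case True
    have "h (y (Suc k)) \<le> h (yhat k) + gh (yhat k) \<bullet> (d - e) + L\<^sub>h / 2 * (norm (d - e))\<^sup>2"
      using lipschitz_gradient_upper_bound[OF h, of "y (Suc k)" "yhat k"] by (simp add: shifts)
    moreover have "h (yhat k) + gh (yhat k) \<bullet> (- e) \<le> h (y k)"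
      using convex_gradient_lower_bound[OF h(1) True, of "yhat k" "y k"] by (simp add: shifts)
    moreover have "gh (yhat k) \<bullet> (d - e) = gh (yhat k) \<bullet> d + gh (yhat k) \<bullet> (- e)"
      by (simp add: inner_simps)
    moreover have "0 \<le> \<beta> / 2 * (norm (B d))\<^sup>2" using \<beta> by simp
    moreover have "L\<^sub>h / 2 * (norm e)\<^sup>2 = \<gamma>\<^sub>y k * (dy k)\<^sup>2"
      using True by (simp add: \<gamma>\<^sub>y norm_e power_mult_distrib)
    moreover have "\<eta>\<^sub>y * (norm d)\<^sup>2 = L\<^sub>h / 2 * (norm d)\<^sup>2" using True by (simp add: \<eta>\<^sub>y)
    ultimately show ?thesis
      using model unfolding norm_d[symmetric] by argo
  next
    case False
    define c where "c = \<beta> * lambda_min (adjoint B \<circ> B) + L\<^sub>h"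
    have \<eta>': "\<eta>\<^sub>y = (1 - \<nu>\<^sub>y) * c / 2" using False by (simp add: \<eta>\<^sub>y c_def)
    have \<nu>': "0 \<le> \<nu>\<^sub>y" "\<nu>\<^sub>y < 1" using \<nu>\<^sub>y by (auto split: if_splits)
    then have c: "0 < c" using \<eta>\<^sub>y_pos unfolding \<eta>' by (simp add: zero_less_mult_iff)
    have "h (y (Suc k)) \<le> h (y k) + gh (y k) \<bullet> d + L\<^sub>h / 2 * (norm d)\<^sup>2"
      using lipschitz_gradient_upper_bound[OF h, of "y (Suc k)" "y k"] by (simp add: d_def)
    moreover have "gh (y k) \<bullet> d - gh (yhat k) \<bullet> d \<le> L\<^sub>h * norm d * norm e"
    proof -
      have "gh (y k) \<bullet> d - gh (yhat k) \<bullet> d \<le> norm (gh (y k) - gh (yhat k)) * norm d"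
        by (metis inner_diff_left norm_cauchy_schwarz)
      also have "\<dots> \<le> (L\<^sub>h * norm e) * norm d"
        using lipschitz_onD[OF h(2), of "y k" "yhat k"]
        by (intro mult_right_mono) (simp_all add: dist_norm e_def norm_minus_commute)
      finally show ?thesis by (simp add: algebra_simps)
    qed
    moreover have "L\<^sub>h * (d \<bullet> e) \<le> L\<^sub>h * norm d * norm e"
      using mult_left_mono[OF norm_cauchy_schwarz[of d e] L\<^sub>h_nonneg] by (simp add: algebra_simps)
    moreover have "c / 2 * (norm d)\<^sup>2 \<le> \<beta> / 2 * (norm (B d))\<^sup>2 + L\<^sub>h / 2 * (norm d)\<^sup>2"
      using mult_left_mono[OF lambda_min_adjoint_comp_le[OF B, of d], of "\<beta> / 2"] \<beta>
      by (simp add: c_def algebra_simps)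
    moreover have "2 * L\<^sub>h * norm d * norm e \<le> \<nu>\<^sub>y * c / 2 * (norm d)\<^sup>2 + \<gamma>\<^sub>y k * (dy k)\<^sup>2"
    proof (cases "\<forall>k. \<delta> k = 0")
      case True
      then show ?thesis using \<nu>' c \<gamma>\<^sub>y_nonneg by (simp add: norm_e)
    next
      case nz: False
      then have "0 < \<nu>\<^sub>y * c" using \<nu>\<^sub>y c by simp
      then have "(2 * L\<^sub>h * \<bar>\<delta> k\<bar>) * norm d * dy k
        \<le> \<nu>\<^sub>y * c / 2 * (norm d)\<^sup>2 + (2 * L\<^sub>h * \<bar>\<delta> k\<bar>)\<^sup>2 / (2 * (\<nu>\<^sub>y * c)) * (dy k)\<^sup>2"
        by (rule young_product)
      also have "(2 * L\<^sub>h * \<bar>\<delta> k\<bar>)\<^sup>2 / (2 * (\<nu>\<^sub>y * c)) = \<gamma>\<^sub>y k"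
        using False by (simp add: \<gamma>\<^sub>y c_def power_mult_distrib)
      finally show ?thesis by (simp add: norm_e algebra_simps)
    qed
    moreover have "\<eta>\<^sub>y * (norm d)\<^sup>2 = c / 2 * (norm d)\<^sup>2 - \<nu>\<^sub>y * c / 2 * (norm d)\<^sup>2"
      by (simp add: \<eta>' field_simps)
    ultimately show ?thesis
      using model sq unfolding norm_d[symmetric] by linarith
  qed
qed

text \<open>
  The optimality condition of the \<open>y\<close> update contains the residual, that is, the step of the
  multiplier; eliminating it leaves a linear recursion for \<open>B\<^sup>*\<omega>\<close>.
\<close>

lemma multiplier_recursion:
  "adjoint B (\<omega> (Suc k)) = (1 - \<alpha>) *\<^sub>R adjoint B (\<omega> k) - \<alpha> *\<^sub>R h_model_grad k"
proof -
  interpret B': linear "adjoint B" using B by (rule adjoint_linear)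
  have "adjoint B (\<omega> k) + gh (yhat k) + \<beta> *\<^sub>R adjoint B (block_map blk s A (x (Suc k)) - b + B (y (Suc k)))
      + L\<^sub>h *\<^sub>R (y (Suc k) - yhat k) = 0"
    by (rule regularized_least_squares_argmin(1)[OF B y_update])
  moreover have "block_map blk s A (x (Suc k)) - b + B (y (Suc k)) = residual (Suc k)"
    by (simp add: residual_def)
  ultimately have "\<beta> *\<^sub>R adjoint B (residual (Suc k)) = - (adjoint B (\<omega> k) + h_model_grad k)"
    unfolding h_model_grad_def by (simp add: eq_neg_iff_add_eq_0 algebra_simps)
  then have "\<alpha> *\<^sub>R (\<beta> *\<^sub>R adjoint B (residual (Suc k))) = \<alpha> *\<^sub>R (- (adjoint B (\<omega> k) + h_model_grad k))"
    by simp
  then show ?thesis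
    unfolding \<omega>_update B'.add B'.scale by (simp add: algebra_simps)
qed

lemma dB\<omega>_recursion:
  assumes k: "1 \<le> k"
  shows "dB\<omega> (Suc k) \<le> \<bar>1 - \<alpha>\<bar> * dB\<omega> k + \<alpha> * norm (h_model_grad k - h_model_grad (k - 1))"
proof -
  interpret B': linear "adjoint B" using B by (rule adjoint_linear)
  have "adjoint B (\<omega> (Suc k) - \<omega> k)
      = (1 - \<alpha>) *\<^sub>R adjoint B (\<omega> k - \<omega> (k - 1)) - \<alpha> *\<^sub>R (h_model_grad k - h_model_grad (k - 1))"
    using multiplier_recursion[of k] multiplier_recursion[of "k - 1"] k
    by (simp add: B'.diff algebra_simps)
  then have "norm (adjoint B (\<omega> (Suc k) - \<omega> k))
      \<le> norm ((1 - \<alpha>) *\<^sub>R adjoint B (\<omega> k - \<omega> (k - 1))) + norm (\<alpha> *\<^sub>R (h_model_grad k - h_model_grad (k - 1)))"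
    by (simp only: norm_triangle_ineq4)
  then show ?thesis using \<alpha> by (simp add: dB\<omega>_def)
qed

lemma h_model_grad_diff_le:
  assumes k: "1 \<le> k"
  shows "norm (h_model_grad k - h_model_grad (k - 1))
    \<le> L\<^sub>h * (dy (Suc k) + 2 * (\<bar>1 + \<delta> k\<bar> * dy k + \<bar>\<delta> (k - 1)\<bar> * dy (k - 1)))"
proof -
  have "0 < k" using k by simp
  have yhat: "yhat k - yhat (k - 1)
      = (1 + \<delta> k) *\<^sub>R (y k - y (k - 1)) - \<delta> (k - 1) *\<^sub>R (y (k - 1) - y (k - 1 - 1))"
    by (simp add: yhat_def algebra_simps)
  have "norm (yhat k - yhat (k - 1))
      \<le> norm ((1 + \<delta> k) *\<^sub>R (y k - y (k - 1))) + norm (\<delta> (k - 1) *\<^sub>R (y (k - 1) - y (k - 1 - 1)))"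
    unfolding yhat by (rule norm_triangle_ineq4)
  then have dyhat: "norm (yhat k - yhat (k - 1)) \<le> \<bar>1 + \<delta> k\<bar> * dy k + \<bar>\<delta> (k - 1)\<bar> * dy (k - 1)"
    by (simp add: dy_def)
  have "h_model_grad k - h_model_grad (k - 1) = (gh (yhat k) - gh (yhat (k - 1)))
      + L\<^sub>h *\<^sub>R (y (Suc k) - y k) - L\<^sub>h *\<^sub>R (yhat k - yhat (k - 1))"
    using \<open>0 < k\<close> by (simp add: h_model_grad_def algebra_simps)
  also have "norm \<dots> \<le> norm (gh (yhat k) - gh (yhat (k - 1)))
      + norm (L\<^sub>h *\<^sub>R (y (Suc k) - y k)) + norm (L\<^sub>h *\<^sub>R (yhat k - yhat (k - 1)))"
    by (intro order.trans[OF norm_triangle_ineq4] add_right_mono norm_triangle_ineq)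
  also have "\<dots> \<le> L\<^sub>h * norm (yhat k - yhat (k - 1)) + L\<^sub>h * dy (Suc k) + L\<^sub>h * norm (yhat k - yhat (k - 1))"
    using lipschitz_onD[OF h(2), of "yhat k" "yhat (k - 1)"] L\<^sub>h_nonneg
    by (simp add: dist_norm dy_def)
  also have "\<dots> = L\<^sub>h * (dy (Suc k) + 2 * norm (yhat k - yhat (k - 1)))"
    by (simp add: algebra_simps)
  also have "\<dots> \<le> L\<^sub>h * (dy (Suc k) + 2 * (\<bar>1 + \<delta> k\<bar> * dy k + \<bar>\<delta> (k - 1)\<bar> * dy (k - 1)))"
    using dyhat L\<^sub>h_nonneg by (intro mult_left_mono) auto
  finally show ?thesis .
qed

text \<open>
  Without extrapolation the sum of three terms is squared directly, which gives the factor
  \<open>\<delta>bar k = 2\<close>; with extrapolation the change of \<open>yhat\<close>, which counts twice, is split once more into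
  two steps, which gives \<open>4 (1 + \<delta>\<^sub>k)\<^sup>2\<close>.
\<close>

lemma h_model_grad_diff_squared_le:
  assumes k: "1 \<le> k"
  shows "(norm (h_model_grad k - h_model_grad (k - 1)))\<^sup>2
    \<le> 3 * L\<^sub>h\<^sup>2 * ((dy (Suc k))\<^sup>2 + \<delta>bar k * (dy k)\<^sup>2 + 4 * (\<delta> (k - 1))\<^sup>2 * (dy (k - 1))\<^sup>2)"
proof -
  let ?S = "dy (Suc k) + 2 * (\<bar>1 + \<delta> k\<bar> * dy k + \<bar>\<delta> (k - 1)\<bar> * dy (k - 1))"
  have "(norm (h_model_grad k - h_model_grad (k - 1)))\<^sup>2 \<le> (L\<^sub>h * ?S)\<^sup>2"
    by (intro power_mono h_model_grad_diff_le k) simp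
  also have "\<dots> = L\<^sub>h\<^sup>2 * ?S\<^sup>2" by (simp add: power_mult_distrib)
  also have "\<dots> \<le> L\<^sub>h\<^sup>2 * (3 * ((dy (Suc k))\<^sup>2 + \<delta>bar k * (dy k)\<^sup>2 + 4 * (\<delta> (k - 1))\<^sup>2 * (dy (k - 1))\<^sup>2))"
  proof (rule mult_left_mono)
    show "?S\<^sup>2 \<le> 3 * ((dy (Suc k))\<^sup>2 + \<delta>bar k * (dy k)\<^sup>2 + 4 * (\<delta> (k - 1))\<^sup>2 * (dy (k - 1))\<^sup>2)"
    proof (cases "\<forall>l. \<delta> l = 0")
      case True
      then show ?thesis
        using norm_add3_squared_le[of "dy (Suc k)" "dy k" "dy k"]
        by (simp add: \<delta>bar add.commute)
    next
      case False
      let ?s = "\<bar>1 + \<delta> k\<bar> * dy k" and ?t = "\<bar>\<delta> (k - 1)\<bar> * dy (k - 1)"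
      have "?S\<^sup>2 \<le> 3 * ((dy (Suc k))\<^sup>2 + (?s + ?t)\<^sup>2 + (?s + ?t)\<^sup>2)"
        using norm_add3_squared_le[of "dy (Suc k)" "?s + ?t" "?s + ?t"] by (simp add: algebra_simps)
      moreover have "(?s + ?t)\<^sup>2 \<le> 2 * (?s\<^sup>2 + ?t\<^sup>2)"
        using sum_squares_bound[of ?s ?t] by (simp add: power2_sum)
      moreover have "?s\<^sup>2 = (1 + \<delta> k)\<^sup>2 * (dy k)\<^sup>2" "?t\<^sup>2 = (\<delta> (k - 1))\<^sup>2 * (dy (k - 1))\<^sup>2"
        by (simp_all only: power_mult_distrib power2_abs)
      moreover have "\<delta>bar k = 4 * (1 + \<delta> k)\<^sup>2" using False by (simp add: \<delta>bar)
      ultimately show ?thesis by simp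
    qed
  qed simp
  finally show ?thesis by (simp only: mult_ac)
qed

text \<open>
  The weight of the squared multiplier step in the Lyapunov function. It is the
  coefficient of the telescoping term that the squared recursion for \<open>dB\<omega>\<close> leaves in the bound on
  \<open>\<parallel>\<omega>\<^sup>k\<^sup>+\<^sup>1 - \<omega>\<^sup>k\<parallel>\<^sup>2 / (\<alpha>\<beta>)\<close>.
\<close>

definition c\<^sub>\<omega> :: real where
  "c\<^sub>\<omega> = \<bar>1 - \<alpha>\<bar> / (\<alpha> * \<beta> * \<sigma>\<^sub>B * (1 - \<bar>1 - \<alpha>\<bar>))"

lemma c\<^sub>\<omega>_nonneg: "0 \<le> c\<^sub>\<omega>"
  unfolding c\<^sub>\<omega>_def using \<alpha> \<beta> \<sigma>\<^sub>B relaxation_pos by simp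

lemma \<sigma>\<^sub>B_norm_le: "\<sigma>\<^sub>B * (norm v)\<^sup>2 \<le> (norm (adjoint B v))\<^sup>2"
  using lambda_min_adjoint_comp_le[OF adjoint_linear[OF B], of v]
  by (simp add: adjoint_adjoint[OF B] \<sigma>\<^sub>B(1))

text \<open>
  The ascent of the Lagrangian in the multiplier update, bounded by a telescoping term and by steps
  of \<open>y\<close>. Splitting \<open>\<bar>1 - \<alpha>\<bar> (dB\<omega> (k+1))\<^sup>2\<close> off the left-hand side of the squared
  recursion makes the term telescope, and dividing by the remaining factor
  \<open>1 - \<bar>1 - \<alpha>\<bar>\<close> is where \<open>\<alpha>\<^sub>2\<close> gets the square in its denominator.
\<close>

lemma multiplier_ascent_le:
  assumes k: "1 \<le> k"
  shows "(norm (\<omega> (Suc k) - \<omega> k))\<^sup>2 / (\<alpha> * \<beta>) \<le> c\<^sub>\<omega> * (dB\<omega> k)\<^sup>2 - c\<^sub>\<omega> * (dB\<omega> (Suc k))\<^sup>2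
    + \<alpha>\<^sub>2 * L\<^sub>h\<^sup>2 / \<beta> * (dy (Suc k))\<^sup>2 + \<alpha>\<^sub>2 * L\<^sub>h\<^sup>2 * \<delta>bar k / \<beta> * (dy k)\<^sup>2
    + 4 * \<alpha>\<^sub>2 * L\<^sub>h\<^sup>2 * (\<delta> (k - 1))\<^sup>2 / \<beta> * (dy (k - 1))\<^sup>2"
proof -
  define \<theta> where "\<theta> = \<bar>1 - \<alpha>\<bar>"
  define Z where "Z = norm (h_model_grad k - h_model_grad (k - 1))"
  define Y where "Y = (dy (Suc k))\<^sup>2 + \<delta>bar k * (dy k)\<^sup>2 + 4 * (\<delta> (k - 1))\<^sup>2 * (dy (k - 1))\<^sup>2"
  have \<theta>: "0 < 1 - \<theta>" using relaxation_pos by (simp add: \<theta>_def)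
  have pos: "0 < \<alpha> * \<beta> * \<sigma>\<^sub>B" using \<alpha> \<beta> \<sigma>\<^sub>B by simp
  have "(dB\<omega> (Suc k))\<^sup>2 \<le> \<theta> * (dB\<omega> k)\<^sup>2 + \<alpha>\<^sup>2 / (1 - \<theta>) * Z\<^sup>2"
    using squared_convex_combination_le[OF \<alpha> dB\<omega>_recursion[OF k]]
    by (simp add: \<theta>_def Z_def dB\<omega>_def)
  then have "(1 - \<theta>) * (dB\<omega> (Suc k))\<^sup>2
      \<le> \<theta> * ((dB\<omega> k)\<^sup>2 - (dB\<omega> (Suc k))\<^sup>2) + \<alpha>\<^sup>2 / (1 - \<theta>) * Z\<^sup>2"
    by (simp add: algebra_simps)
  then have "(dB\<omega> (Suc k))\<^sup>2
      \<le> (\<theta> * ((dB\<omega> k)\<^sup>2 - (dB\<omega> (Suc k))\<^sup>2) + \<alpha>\<^sup>2 / (1 - \<theta>) * Z\<^sup>2) / (1 - \<theta>)"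
    using \<theta> by (simp add: pos_le_divide_eq mult.commute)
  moreover have "\<sigma>\<^sub>B * (norm (\<omega> (Suc k) - \<omega> k))\<^sup>2 \<le> (dB\<omega> (Suc k))\<^sup>2"
    using \<sigma>\<^sub>B_norm_le[of "\<omega> (Suc k) - \<omega> k"] by (simp add: dB\<omega>_def)
  ultimately have "\<sigma>\<^sub>B * (norm (\<omega> (Suc k) - \<omega> k))\<^sup>2
      \<le> (\<theta> * ((dB\<omega> k)\<^sup>2 - (dB\<omega> (Suc k))\<^sup>2) + \<alpha>\<^sup>2 / (1 - \<theta>) * Z\<^sup>2) / (1 - \<theta>)"
    by linarith
  then have "\<sigma>\<^sub>B * (norm (\<omega> (Suc k) - \<omega> k))\<^sup>2 / (\<alpha> * \<beta> * \<sigma>\<^sub>B)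
      \<le> (\<theta> * ((dB\<omega> k)\<^sup>2 - (dB\<omega> (Suc k))\<^sup>2) + \<alpha>\<^sup>2 / (1 - \<theta>) * Z\<^sup>2) / (1 - \<theta>) / (\<alpha> * \<beta> * \<sigma>\<^sub>B)"
    using pos by (intro divide_right_mono) auto
  also have "\<dots> = c\<^sub>\<omega> * ((dB\<omega> k)\<^sup>2 - (dB\<omega> (Suc k))\<^sup>2) + \<alpha>\<^sub>2 / (3 * \<beta>) * Z\<^sup>2"
    unfolding c\<^sub>\<omega>_def \<alpha>\<^sub>2 \<theta>_def[symmetric] using \<theta> \<alpha> \<beta> \<sigma>\<^sub>B
    by (simp add: add_divide_distrib power2_eq_square mult_ac)
  also have "\<sigma>\<^sub>B * (norm (\<omega> (Suc k) - \<omega> k))\<^sup>2 / (\<alpha> * \<beta> * \<sigma>\<^sub>B)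
      = (norm (\<omega> (Suc k) - \<omega> k))\<^sup>2 / (\<alpha> * \<beta>)"
    using \<sigma>\<^sub>B by simp
  finally have "(norm (\<omega> (Suc k) - \<omega> k))\<^sup>2 / (\<alpha> * \<beta>)
      \<le> c\<^sub>\<omega> * ((dB\<omega> k)\<^sup>2 - (dB\<omega> (Suc k))\<^sup>2) + \<alpha>\<^sub>2 / (3 * \<beta>) * Z\<^sup>2" .
  moreover have "\<alpha>\<^sub>2 / (3 * \<beta>) * Z\<^sup>2 \<le> \<alpha>\<^sub>2 / (3 * \<beta>) * (3 * L\<^sub>h\<^sup>2 * Y)"
    unfolding Z_def Y_def using \<alpha>\<^sub>2_pos \<beta>
    by (intro mult_left_mono h_model_grad_diff_squared_le[OF k]) auto
  moreover have "\<alpha>\<^sub>2 / (3 * \<beta>) * (3 * L\<^sub>h\<^sup>2 * Y) = \<alpha>\<^sub>2 * L\<^sub>h\<^sup>2 / \<beta> * (dy (Suc k))\<^sup>2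
    + \<alpha>\<^sub>2 * L\<^sub>h\<^sup>2 * \<delta>bar k / \<beta> * (dy k)\<^sup>2 + 4 * \<alpha>\<^sub>2 * L\<^sub>h\<^sup>2 * (\<delta> (k - 1))\<^sup>2 / \<beta> * (dy (k - 1))\<^sup>2"
    using \<beta> by (simp add: Y_def field_simps)
  ultimately show ?thesis by (simp add: algebra_simps)
qed

lemma iteration_descent:
  assumes k: "1 \<le> k"
  shows "lagrangian_value (Suc k) + c\<^sub>\<omega> * (dB\<omega> (Suc k))\<^sup>2 + (\<Sum>i = 1..s. \<eta> i * (dx i (Suc k))\<^sup>2)
      + \<mu> * (dy (Suc k))\<^sup>2
    \<le> lagrangian_value k + c\<^sub>\<omega> * (dB\<omega> k)\<^sup>2 + C\<^sub>x * (\<Sum>i = 1..s. \<eta> i * (dx i k)\<^sup>2)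
      + C\<^sub>1 * \<mu> * (dy k)\<^sup>2 + C\<^sub>2 * \<mu> * (dy (k - 1))\<^sup>2"
proof -
  have "(\<omega> (Suc k) - \<omega> k) \<bullet> residual (Suc k) = (norm (\<omega> (Suc k) - \<omega> k))\<^sup>2 / (\<alpha> * \<beta>)"
    using \<alpha> \<beta> by (simp add: \<omega>_update dot_square_norm power2_eq_square)
  then have dual: "\<omega> (Suc k) \<bullet> residual (Suc k)
      = \<omega> k \<bullet> residual (Suc k) + (norm (\<omega> (Suc k) - \<omega> k))\<^sup>2 / (\<alpha> * \<beta>)"
    by (simp add: inner_diff_left)
  have "(\<Sum>i = 1..s. \<gamma> i k * (dx i k)\<^sup>2) \<le> (\<Sum>i = 1..s. C\<^sub>x * (\<eta> i * (dx i k)\<^sup>2))"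
  proof (rule sum_mono)
    fix i assume "i \<in> {1..s}"
    from mult_right_mono[OF cond_x[OF k this], of "(dx i k)\<^sup>2"]
    show "\<gamma> i k * (dx i k)\<^sup>2 \<le> C\<^sub>x * (\<eta> i * (dx i k)\<^sup>2)" by simp
  qed
  then have x: "(\<Sum>i = 1..s. \<gamma> i k * (dx i k)\<^sup>2) \<le> C\<^sub>x * (\<Sum>i = 1..s. \<eta> i * (dx i k)\<^sup>2)"
    by (simp add: sum_distrib_left)
  have y1: "4 * \<alpha>\<^sub>2 * L\<^sub>h\<^sup>2 * (\<delta> (k - 1))\<^sup>2 / \<beta> * (dy (k - 1))\<^sup>2 \<le> C\<^sub>2 * \<mu> * (dy (k - 1))\<^sup>2"
    by (intro mult_right_mono cond_y(1) k) simp
  have y2: "\<alpha>\<^sub>2 * L\<^sub>h\<^sup>2 * \<delta>bar k / \<beta> * (dy k)\<^sup>2 + \<gamma>\<^sub>y k * (dy k)\<^sup>2 \<le> C\<^sub>1 * \<mu> * (dy k)\<^sup>2"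
    using mult_right_mono[OF cond_y(2)[OF k], of "(dy k)\<^sup>2"] by (simp add: distrib_right)
  have \<mu>_dy: "\<mu> * (dy (Suc k))\<^sup>2 = \<eta>\<^sub>y * (dy (Suc k))\<^sup>2 - \<alpha>\<^sub>2 * L\<^sub>h\<^sup>2 / \<beta> * (dy (Suc k))\<^sup>2"
    by (simp add: \<mu>(1) left_diff_distrib)
  show ?thesis
    using sweep_descent[OF k] y_descent[of k] multiplier_ascent_le[OF k] x y1 y2 \<mu>_dy dual
    unfolding lagrangian_value_def residual_def by linarith
qed

section \<open>Vanishing steps\<close>

text \<open>
  Objective values are bounded below, and the coupling terms are bounded below by
  \<open>- \<parallel>\<omega>\<^sup>k\<parallel>\<^sup>2 / (2\<beta>)\<close> by Young's inequality, hence uniformly in \<open>k\<close> as the multipliers are bounded.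
\<close>

lemma lagrangian_bounded_below: "\<exists>c. \<forall>k\<ge>1. c \<le> lagrangian_value k"
proof -
  obtain c where c: "\<And>z w. ereal c \<le> F z + ereal (h w)" using bdd_below by blast
  obtain K where K: "\<And>k. norm (\<omega> k) \<le> K"
    using bounded_\<omega> by (auto simp: bounded_iff)
  have "c - K\<^sup>2 / (2 * \<beta>) \<le> lagrangian_value k" if k: "1 \<le> k" for k
  proof -
    have g: "g i (block blk i (x k)) = ereal (g_value i k)" if "i \<in> {1..s}" for i
      using g_finite[OF that, of "k - 1"] k by simp
    have "(\<Sum>i = 1..s. g i (block blk i (x k))) = (\<Sum>i = 1..s. ereal (g_value i k))"
      by (intro sum.cong refl g)
    then have "c \<le> f (x k) + (\<Sum>i = 1..s. g_value i k) + h (y k)"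
      using c[of "x k" "y k"] by (simp add: F composite_obj_def)
    moreover have "- (K\<^sup>2 / (2 * \<beta>)) \<le> \<omega> k \<bullet> residual k + \<beta> / 2 * (norm (residual k))\<^sup>2"
    proof -
      have "- (\<omega> k \<bullet> residual k) \<le> 1 * norm (\<omega> k) * norm (residual k)"
        using Cauchy_Schwarz_ineq2[of "\<omega> k" "residual k"] by simp
      also have "\<dots> = 1 * norm (residual k) * norm (\<omega> k)" by simp
      also have "\<dots> \<le> \<beta> / 2 * (norm (residual k))\<^sup>2 + 1\<^sup>2 / (2 * \<beta>) * (norm (\<omega> k))\<^sup>2"
        using \<beta> by (rule young_product)
      also have "1\<^sup>2 / (2 * \<beta>) * (norm (\<omega> k))\<^sup>2 \<le> 1\<^sup>2 / (2 * \<beta>) * K\<^sup>2"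
        using \<beta> by (intro mult_left_mono power_mono K) auto
      finally show ?thesis by simp
    qed
    ultimately show ?thesis unfolding lagrangian_value_def by linarith
  qed
  then show ?thesis by blast
qed

lemma weighted_dx_nonneg: "i \<in> {1..s} \<Longrightarrow> 0 \<le> \<eta> i * (dx i k)\<^sup>2"
  using \<eta>[of i] by simp

text \<open>
  The Lyapunov function \<open>\<Phi>\<close> carries the part of the previous steps that the next iteration can give
  back: \<open>C\<^sub>x\<close> of the \<open>x\<close> steps, \<open>C\<^sub>1 + C\<^sub>2 = C\<^sub>y\<close> of the last \<open>y\<close> step and \<open>C\<^sub>2\<close> of the one before.
  The remaining fractions \<open>1 - C\<^sub>x\<close> and \<open>1 - C\<^sub>y\<close> of the new steps are pure decrease.
\<close>

lemma weighted_steps_vanish: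
  "(\<lambda>k. (1 - C\<^sub>x) * (\<Sum>i = 1..s. \<eta> i * (dx i k)\<^sup>2) + (1 - C\<^sub>y) * \<mu> * (dy k)\<^sup>2) \<longlonglongrightarrow> 0"
proof -
  let ?X = "\<lambda>k. \<Sum>i = 1..s. \<eta> i * (dx i k)\<^sup>2"
  define \<Phi> where "\<Phi> k = lagrangian_value k + c\<^sub>\<omega> * (dB\<omega> k)\<^sup>2 + C\<^sub>x * ?X k + C\<^sub>y * (\<mu> * (dy k)\<^sup>2)
      + C\<^sub>2 * (\<mu> * (dy (k - 1))\<^sup>2)" for k
  define D where "D k = (1 - C\<^sub>x) * ?X k + (1 - C\<^sub>y) * (\<mu> * (dy k)\<^sup>2)" for k
  have X: "0 \<le> ?X k" for k
    by (intro sum_nonneg weighted_dx_nonneg)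
  obtain c where c: "\<And>k. 1 \<le> k \<Longrightarrow> c \<le> lagrangian_value k" using lagrangian_bounded_below by blast
  \<comment> \<open>The descent inequality holds from \<open>k = 1\<close> on and bounds the step that leads to \<open>k + 1\<close>.\<close>
  have "(\<lambda>k. D (Suc (Suc k))) \<longlonglongrightarrow> 0"
  proof (rule decrease_tendsto_0)
    fix k
    have C\<^sub>1: "C\<^sub>1 = C\<^sub>y - C\<^sub>2" using C\<^sub>1\<^sub>2_nonneg by simp
    show "\<Phi> (Suc (Suc k)) + D (Suc (Suc k)) \<le> \<Phi> (Suc k)"
      using iteration_descent[of "Suc k"] unfolding \<Phi>_def D_def C\<^sub>1
      by (simp add: algebra_simps)
    show "0 \<le> D (Suc (Suc k))"
      unfolding D_def using X C \<mu> by (intro add_nonneg_nonneg mult_nonneg_nonneg) auto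
    have "0 \<le> c\<^sub>\<omega> * (dB\<omega> (Suc k))\<^sup>2" "0 \<le> C\<^sub>x * ?X (Suc k)" "0 \<le> C\<^sub>y * (\<mu> * (dy (Suc k))\<^sup>2)"
      "0 \<le> C\<^sub>2 * (\<mu> * (dy k)\<^sup>2)"
      using c\<^sub>\<omega>_nonneg X C \<mu> C\<^sub>1\<^sub>2_nonneg by simp_all
    then show "c \<le> \<Phi> (Suc k)"
      using c[of "Suc k"] unfolding \<Phi>_def by simp
  qed
  then have "(\<lambda>k. D (Suc k)) \<longlonglongrightarrow> 0" by (rule LIMSEQ_imp_Suc)
  then have "D \<longlonglongrightarrow> 0" by (rule LIMSEQ_imp_Suc)
  then show ?thesis by (simp add: D_def[abs_def] mult.assoc)
qed

lemma dx_tendsto_0: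
  assumes i: "i \<in> {1..s}"
  shows "dx i \<longlonglongrightarrow> 0"
proof -
  let ?D = "\<lambda>k. (1 - C\<^sub>x) * (\<Sum>i = 1..s. \<eta> i * (dx i k)\<^sup>2) + (1 - C\<^sub>y) * \<mu> * (dy k)\<^sup>2"
  have c: "0 < (1 - C\<^sub>x) * \<eta> i" using C \<eta>[OF i] by simp
  have "norm ((dx i k)\<^sup>2) \<le> ?D k / ((1 - C\<^sub>x) * \<eta> i)" for k
  proof -
    have "\<eta> i * (dx i k)\<^sup>2 \<le> (\<Sum>i = 1..s. \<eta> i * (dx i k)\<^sup>2)"
      using i weighted_dx_nonneg by (intro member_le_sum) auto
    then have "(1 - C\<^sub>x) * (\<eta> i * (dx i k)\<^sup>2) \<le> (1 - C\<^sub>x) * (\<Sum>i = 1..s. \<eta> i * (dx i k)\<^sup>2)"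
      using C by (intro mult_left_mono) auto
    moreover have "0 \<le> (1 - C\<^sub>y) * \<mu> * (dy k)\<^sup>2" using C \<mu> by simp
    ultimately show ?thesis
      unfolding pos_le_divide_eq[OF c] by (simp add: mult_ac)
  qed
  moreover have "(\<lambda>k. ?D k / ((1 - C\<^sub>x) * \<eta> i)) \<longlonglongrightarrow> 0"
    using weighted_steps_vanish by (rule tendsto_divide_zero)
  ultimately have "(\<lambda>k. (dx i k)\<^sup>2) \<longlonglongrightarrow> 0"
    by (rule tendsto_0_comparison)
  then show ?thesis
    by (simp add: power_tendsto_0_iff)
qed

lemma dy_tendsto_0: "dy \<longlonglongrightarrow> 0"
proof -
  let ?D = "\<lambda>k. (1 - C\<^sub>x) * (\<Sum>i = 1..s. \<eta> i * (dx i k)\<^sup>2) + (1 - C\<^sub>y) * \<mu> * (dy k)\<^sup>2"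
  have c: "0 < (1 - C\<^sub>y) * \<mu>" using C \<mu> by simp
  have "norm ((dy k)\<^sup>2) \<le> ?D k / ((1 - C\<^sub>y) * \<mu>)" for k
  proof -
    have "0 \<le> (1 - C\<^sub>x) * (\<Sum>i = 1..s. \<eta> i * (dx i k)\<^sup>2)"
      using C by (intro mult_nonneg_nonneg sum_nonneg weighted_dx_nonneg) auto
    then show ?thesis
      unfolding pos_le_divide_eq[OF c] by (simp add: mult_ac)
  qed
  moreover have "(\<lambda>k. ?D k / ((1 - C\<^sub>y) * \<mu>)) \<longlonglongrightarrow> 0"
    using weighted_steps_vanish by (rule tendsto_divide_zero)
  ultimately have "(\<lambda>k. (dy k)\<^sup>2) \<longlonglongrightarrow> 0"
    by (rule tendsto_0_comparison)
  then show ?thesis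
    by (simp add: power_tendsto_0_iff)
qed

lemma x_step_tendsto_0: "(\<lambda>k. x k - x (k - 1)) \<longlonglongrightarrow> 0"
proof -
  have "(\<lambda>k. \<Sum>i = 1..s. block blk i (x k - x (k - 1))) \<longlonglongrightarrow> (\<Sum>i = 1..s. 0)"
    by (intro tendsto_sum) (rule tendsto_norm_zero_cancel, use dx_tendsto_0 in \<open>simp add: dx_def[abs_def]\<close>)
  then show ?thesis unfolding sum_blocks[OF blk] by simp
qed

text \<open>
  The condition \<open>\<gamma>\<^sub>i\<^sup>k \<le> C\<^sub>x \<eta>\<^sub>i\<close> bounds the extrapolation parameters of block \<open>i\<close>, so that extrapolated
  points have the same limits as the iterates.
\<close>

lemma x_extrapolation_tendsto_0:
  assumes i: "i \<in> {1..s}"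
  shows "(\<lambda>k. \<zeta> i k *\<^sub>R block blk i (x k - x (k - 1))) \<longlonglongrightarrow> 0"
proof -
  define a where "a = onorm (adjoint (A i) \<circ> A i)"
  have "bounded_linear (adjoint (A i) \<circ> A i)"
    using A(1)[OF i] by (simp add: linear_linear linear_compose adjoint_linear)
  then have a: "0 \<le> a" unfolding a_def by (rule onorm_pos_le)
  have "\<exists>M. \<forall>k\<ge>1. (\<zeta> i k)\<^sup>2 \<le> M"
  proof -
    from \<kappa>_\<eta>_\<gamma>[OF i] consider
      (general) "\<kappa> i > a" "\<forall>k. \<gamma> i k = (\<beta> * \<zeta> i k * (\<kappa> i + a))\<^sup>2 / (2 * \<nu> i * (\<kappa> i - a) * \<beta>)"
    | (convex) "\<eta> i = \<beta> * a / 2" "\<forall>k. \<gamma> i k = \<beta> * a * (\<zeta> i k)\<^sup>2 / 2"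
      unfolding Let_def a_def[symmetric] by auto
    then show ?thesis
    proof cases
      case general
      show ?thesis
      proof (cases "\<forall>k. \<zeta> i k = 0")
        case True
        then show ?thesis by auto
      next
        case False
        define p q where "p = (\<beta> * (\<kappa> i + a))\<^sup>2" and "q = 2 * \<nu> i * (\<kappa> i - a) * \<beta>"
        have pq: "0 < p" "0 < q"
          using False \<nu>[OF i] general \<beta> a by (simp_all add: p_def q_def)
        have "(\<zeta> i k)\<^sup>2 \<le> C\<^sub>x * \<eta> i * q / p" if "1 \<le> k" for k
        proof -
          have "(\<zeta> i k)\<^sup>2 * p / q \<le> C\<^sub>x * \<eta> i"
            using cond_x[OF that i] general(2) by (simp add: p_def q_def power_mult_distrib mult_ac)
          then show ?thesis using pq by (simp add: field_simps)
        qed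
        then show ?thesis by blast
      qed
    next
      case convex
      have "0 < \<beta> * a / 2" using \<eta>[OF i] convex by simp
      moreover have "\<beta> * a / 2 * (\<zeta> i k)\<^sup>2 \<le> \<beta> * a / 2 * C\<^sub>x" if "1 \<le> k" for k
        using cond_x[OF that i] convex by (simp add: mult_ac)
      ultimately have "(\<zeta> i k)\<^sup>2 \<le> C\<^sub>x" if "1 \<le> k" for k
        using that mult_le_cancel_left_pos by blast
      then show ?thesis by blast
    qed
  qed
  then obtain M where M: "\<And>k. 1 \<le> k \<Longrightarrow> (\<zeta> i k)\<^sup>2 \<le> M" by blast
  have "\<forall>\<^sub>F k in sequentially. norm (\<zeta> i k *\<^sub>R block blk i (x k - x (k - 1))) \<le> sqrt M * dx i k"
    unfolding eventually_sequentially
  proof (intro exI[of _ 1] allI impI)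
    fix k :: nat assume "1 \<le> k"
    then have "\<bar>\<zeta> i k\<bar> \<le> sqrt M" using M real_le_rsqrt[of "\<bar>\<zeta> i k\<bar>" M] by simp
    then show "norm (\<zeta> i k *\<^sub>R block blk i (x k - x (k - 1))) \<le> sqrt M * dx i k"
      by (simp add: dx_def mult_right_mono)
  qed
  moreover have "(\<lambda>k. sqrt M * dx i k) \<longlonglongrightarrow> 0"
    using dx_tendsto_0[OF i] by (rule tendsto_mult_right_zero)
  ultimately show ?thesis by (rule Lim_null_comparison)
qed

text \<open>
  The condition on \<open>\<delta>bar k\<close> bounds \<open>L\<^sub>h \<bar>1 + \<delta>\<^sub>k\<bar>\<close>. It is the product with \<open>L\<^sub>h\<close> that matters,
  since the extrapolated point \<open>yhat k\<close> enters through \<open>gh\<close>, which is \<open>L\<^sub>h\<close>-Lipschitz, and through a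
  proximal term with factor \<open>L\<^sub>h\<close>.
\<close>

lemma L\<^sub>h_\<delta>_bounded: "\<exists>M\<ge>0. \<forall>k\<ge>1. L\<^sub>h * \<bar>\<delta> k\<bar> \<le> M"
proof (cases "\<forall>k. \<delta> k = 0")
  case False
  define K where "K = C\<^sub>1 * \<mu> * \<beta> / (4 * \<alpha>\<^sub>2)"
  have "L\<^sub>h * \<bar>\<delta> k\<bar> \<le> sqrt K + L\<^sub>h" if k: "1 \<le> k" for k
  proof -
    have "\<alpha>\<^sub>2 * L\<^sub>h\<^sup>2 * (4 * (1 + \<delta> k)\<^sup>2) / \<beta> \<le> C\<^sub>1 * \<mu>"
      using cond_y(2)[OF k] \<gamma>\<^sub>y_nonneg[of k] False by (simp add: \<delta>bar)
    then have "(L\<^sub>h * (1 + \<delta> k))\<^sup>2 \<le> K"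
      using \<alpha>\<^sub>2_pos \<beta> unfolding power_mult_distrib by (simp add: K_def pos_le_divide_eq pos_divide_le_eq mult_ac)
    then have "\<bar>L\<^sub>h * (1 + \<delta> k)\<bar> \<le> sqrt K"
      using real_le_rsqrt[of "\<bar>L\<^sub>h * (1 + \<delta> k)\<bar>" K] by simp
    moreover have "L\<^sub>h * \<bar>\<delta> k\<bar> = \<bar>L\<^sub>h * (1 + \<delta> k) - L\<^sub>h\<bar>"
      using L\<^sub>h_nonneg by (simp add: algebra_simps abs_mult)
    ultimately show ?thesis using L\<^sub>h_nonneg by linarith
  qed
  moreover have "0 \<le> sqrt K + L\<^sub>h"
    using C\<^sub>1\<^sub>2_nonneg \<mu> \<beta> \<alpha>\<^sub>2_pos L\<^sub>h_nonneg by (simp add: K_def)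
  ultimately show ?thesis by blast
qed auto

lemma L\<^sub>h_y_extrapolation_tendsto_0: "(\<lambda>k. L\<^sub>h * \<bar>\<delta> k\<bar> * dy k) \<longlonglongrightarrow> 0"
proof -
  obtain M where M: "0 \<le> M" "\<And>k. 1 \<le> k \<Longrightarrow> L\<^sub>h * \<bar>\<delta> k\<bar> \<le> M" using L\<^sub>h_\<delta>_bounded by blast
  have "\<forall>\<^sub>F k in sequentially. norm (L\<^sub>h * \<bar>\<delta> k\<bar> * dy k) \<le> M * dy k"
    unfolding eventually_sequentially
  proof (intro exI[of _ 1] allI impI)
    fix k :: nat assume "1 \<le> k"
    then show "norm (L\<^sub>h * \<bar>\<delta> k\<bar> * dy k) \<le> M * dy k"
      using M(2)[of k] L\<^sub>h_nonneg by (simp add: dy_def abs_mult mult_right_mono)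
  qed
  moreover have "(\<lambda>k. M * dy k) \<longlonglongrightarrow> 0"
    using dy_tendsto_0 by (rule tendsto_mult_right_zero)
  ultimately show ?thesis by (rule Lim_null_comparison)
qed

lemma h_model_grad_tendsto: "(\<lambda>k. h_model_grad k - gh (y k)) \<longlonglongrightarrow> 0"
proof (rule tendsto_0_comparison)
  fix k
  have "h_model_grad k - gh (y k)
      = (gh (yhat k) - gh (y k)) + L\<^sub>h *\<^sub>R (y (Suc k) - y k) - L\<^sub>h *\<^sub>R (yhat k - y k)"
    by (simp add: h_model_grad_def algebra_simps)
  also have "norm \<dots> \<le> norm (gh (yhat k) - gh (y k)) + norm (L\<^sub>h *\<^sub>R (y (Suc k) - y k))
      + norm (L\<^sub>h *\<^sub>R (yhat k - y k))"
    by (intro order.trans[OF norm_triangle_ineq4] add_right_mono norm_triangle_ineq)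
  also have "\<dots> \<le> L\<^sub>h * norm (yhat k - y k) + L\<^sub>h * dy (Suc k) + L\<^sub>h * norm (yhat k - y k)"
    using lipschitz_onD[OF h(2), of "yhat k" "y k"] L\<^sub>h_nonneg by (simp add: dist_norm dy_def)
  also have "norm (yhat k - y k) = \<bar>\<delta> k\<bar> * dy k" by (simp add: yhat_def dy_def)
  finally show "norm (h_model_grad k - gh (y k)) \<le> 2 * (L\<^sub>h * \<bar>\<delta> k\<bar> * dy k) + L\<^sub>h * dy (Suc k)"
    by (simp add: algebra_simps)
next
  have "(\<lambda>k. 2 * (L\<^sub>h * \<bar>\<delta> k\<bar> * dy k) + L\<^sub>h * dy (Suc k)) \<longlonglongrightarrow> 2 * 0 + L\<^sub>h * 0"
    by (intro tendsto_add tendsto_mult_left L\<^sub>h_y_extrapolation_tendsto_0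
        LIMSEQ_Suc[OF dy_tendsto_0])
  then show "(\<lambda>k. 2 * (L\<^sub>h * \<bar>\<delta> k\<bar> * dy k) + L\<^sub>h * dy (Suc k)) \<longlonglongrightarrow> 0" by simp
qed

text \<open>
  The recursion for \<open>dB\<omega>\<close> is a contraction perturbed by changes of \<open>h_model_grad\<close>, which vanish with
  the steps of \<open>y\<close>; injectivity of \<open>B\<^sup>*\<close>, quantified by \<open>\<sigma>\<^sub>B\<close>, removes the adjoint.
\<close>

lemma multiplier_step_tendsto_0: "(\<lambda>k. \<omega> (Suc k) - \<omega> k) \<longlonglongrightarrow> 0"
proof -
  have bound: "norm (h_model_grad (Suc k) - h_model_grad k)
      \<le> L\<^sub>h * dy (Suc (Suc k)) + 2 * (L\<^sub>h * dy (Suc k)) + 2 * (L\<^sub>h * \<bar>\<delta> (Suc k)\<bar> * dy (Suc k))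
        + 2 * (L\<^sub>h * \<bar>\<delta> k\<bar> * dy k)" (is "_ \<le> ?e k") for k
  proof -
    have "L\<^sub>h * (\<bar>1 + \<delta> (Suc k)\<bar> * dy (Suc k)) \<le> L\<^sub>h * ((1 + \<bar>\<delta> (Suc k)\<bar>) * dy (Suc k))"
      using L\<^sub>h_nonneg by (intro mult_left_mono mult_right_mono) (auto simp: dy_def)
    then show ?thesis
      using h_model_grad_diff_le[of "Suc k"] by (simp add: algebra_simps)
  qed
  have "?e \<longlonglongrightarrow> L\<^sub>h * 0 + 2 * (L\<^sub>h * 0) + 2 * 0 + 2 * 0"
    by (intro tendsto_add tendsto_mult_left L\<^sub>h_y_extrapolation_tendsto_0 dy_tendsto_0
        LIMSEQ_Suc[OF L\<^sub>h_y_extrapolation_tendsto_0] LIMSEQ_Suc[OF dy_tendsto_0]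
        LIMSEQ_Suc[OF LIMSEQ_Suc[OF dy_tendsto_0]])
  then have "?e \<longlonglongrightarrow> 0" by simp
  with bound have "(\<lambda>k. h_model_grad (Suc k) - h_model_grad k) \<longlonglongrightarrow> 0"
    by (rule tendsto_0_comparison)
  then have vanish: "(\<lambda>k. \<alpha> * norm (h_model_grad (Suc k) - h_model_grad k)) \<longlonglongrightarrow> 0"
    by (intro tendsto_mult_right_zero tendsto_norm_zero)
  have rec: "dB\<omega> (Suc (Suc k)) \<le> \<bar>1 - \<alpha>\<bar> * dB\<omega> (Suc k)
      + \<alpha> * norm (h_model_grad (Suc k) - h_model_grad k)" for k
    using dB\<omega>_recursion[of "Suc k"] by simp
  have "(\<lambda>k. dB\<omega> (Suc k)) \<longlonglongrightarrow> 0"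
    by (rule perturbed_contraction_tendsto_0[OF rec _ _ _ vanish])
       (use relaxation_pos in \<open>simp_all add: dB\<omega>_def\<close>)
  then have "(\<lambda>k. dB\<omega> (Suc k) / sqrt \<sigma>\<^sub>B) \<longlonglongrightarrow> 0"
    by (rule tendsto_divide_zero)
  moreover have "norm (\<omega> (Suc k) - \<omega> k) \<le> dB\<omega> (Suc k) / sqrt \<sigma>\<^sub>B" for k
  proof -
    have "(norm (\<omega> (Suc k) - \<omega> k) * sqrt \<sigma>\<^sub>B)\<^sup>2 \<le> (dB\<omega> (Suc k))\<^sup>2"
      using \<sigma>\<^sub>B_norm_le[of "\<omega> (Suc k) - \<omega> k"] \<sigma>\<^sub>B
      by (simp add: dB\<omega>_def power_mult_distrib mult.commute)
    then have "norm (\<omega> (Suc k) - \<omega> k) * sqrt \<sigma>\<^sub>B \<le> dB\<omega> (Suc k)"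
      by (rule power2_le_imp_le) (simp add: dB\<omega>_def)
    then show ?thesis using \<sigma>\<^sub>B by (simp add: pos_le_divide_eq)
  qed
  ultimately show ?thesis
    by (rule tendsto_0_comparison[rotated])
qed

lemma residual_tendsto_0: "residual \<longlonglongrightarrow> 0"
proof -
  have "residual (Suc k) = (1 / (\<alpha> * \<beta>)) *\<^sub>R (\<omega> (Suc k) - \<omega> k)" for k
    using \<alpha> \<beta> by (simp add: \<omega>_update)
  then have "(\<lambda>k. residual (Suc k)) \<longlonglongrightarrow> (1 / (\<alpha> * \<beta>)) *\<^sub>R 0"
    by (simp only:) (intro tendsto_scaleR tendsto_const multiplier_step_tendsto_0)
  then show ?thesis by (simp add: filterlim_sequentially_Suc)
qed

section \<open>Limit points\<close>

context
  fixes r :: "nat \<Rightarrow> nat" and xs :: "real^'n" and ys :: "real^'q" and \<omega>s :: "real^'m"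
  assumes r: "strict_mono r"
    and lim_x: "(\<lambda>k. x (r k)) \<longlonglongrightarrow> xs"
    and lim_y: "(\<lambda>k. y (r k)) \<longlonglongrightarrow> ys"
    and lim_\<omega>: "(\<lambda>k. \<omega> (r k)) \<longlonglongrightarrow> \<omega>s"
begin

lemma along_r: "X \<longlonglongrightarrow> l \<Longrightarrow> (\<lambda>k. X (r k)) \<longlonglongrightarrow> l"
  using LIMSEQ_subseq_LIMSEQ[OF _ r] by (simp add: o_def)

lemma limit_feasible: "block_map blk s A xs + B ys - b = 0"
proof -
  have "bounded_linear (block_map blk s A)" "bounded_linear B"
    using linear_block_map[of s A] A(1) B by (simp_all add: linear_linear)
  then have "(\<lambda>k. residual (r k)) \<longlonglongrightarrow> block_map blk s A xs + B ys - b"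
    unfolding residual_def
    by (intro tendsto_intros bounded_linear.tendsto[of "block_map blk s A"]
        bounded_linear.tendsto[of B] lim_x lim_y)
  moreover have "(\<lambda>k. residual (r k)) \<longlonglongrightarrow> 0"
    by (rule along_r[OF residual_tendsto_0])
  ultimately show ?thesis by (rule LIMSEQ_unique)
qed

lemma lim_x_Suc: "(\<lambda>k. x (Suc (r k))) \<longlonglongrightarrow> xs"
proof -
  have "(\<lambda>k. x (Suc k) - x k) \<longlonglongrightarrow> 0"
    using LIMSEQ_Suc[OF x_step_tendsto_0] by simp
  from tendsto_add[OF lim_x along_r[OF this]] show ?thesis by simp
qed

lemma lim_partial_x: "(\<lambda>k. partial_x i (r k)) \<longlonglongrightarrow> xs"
  unfolding partial_x_def by (intro tendsto_partial_update lim_x_Suc lim_x)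

lemma lim_block: "X \<longlonglongrightarrow> l \<Longrightarrow> (\<lambda>k. block blk i (X k)) \<longlonglongrightarrow> block blk i l"
  using linear_block by (intro bounded_linear.tendsto[of "block blk i"]) (simp add: linear_linear)

lemma lim_xbar:
  assumes i: "i \<in> {1..s}"
  shows "(\<lambda>k. xbar i (r k)) \<longlonglongrightarrow> block blk i xs"
proof -
  have "xbar i k = block blk i (x k) + \<zeta> i k *\<^sub>R block blk i (x k - x (k - 1))" for k
    by (simp add: xbar_def linear_add[OF linear_block] linear_scale[OF linear_block])
  then show ?thesis
    using tendsto_add[OF lim_block[OF lim_x] along_r[OF x_extrapolation_tendsto_0[OF i]], of i] by simp
qed

text \<open>
  The penalty contribution to the linear term vanishes in the limit because the limit point is
  feasible.
\<close>

lemma lim_linear_coef: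
  assumes i: "i \<in> {1..s}"
  shows "(\<lambda>k. linear_coef i (r k)) \<longlonglongrightarrow> adjoint (A i) \<omega>s"
proof -
  have bl: "bounded_linear (block_map blk s A)" "bounded_linear B" "bounded_linear (adjoint (A i))"
    using linear_block_map[of s A] A(1) B adjoint_linear[OF A(1)[OF i]]
    by (simp_all add: linear_linear)
  have "(\<lambda>k. with_block blk i (xbar i (r k)) (partial_x i (r k))) \<longlonglongrightarrow> xs"
    using tendsto_with_block[OF lim_xbar[OF i] lim_partial_x, of blk i] by simp
  then have "(\<lambda>k. linear_coef i (r k)) \<longlonglongrightarrow>
      adjoint (A i) (\<omega>s + \<beta> *\<^sub>R (block_map blk s A xs + B ys - b))"
    unfolding linear_coef_def
    by (intro bounded_linear.tendsto[OF bl(3)] tendsto_add tendsto_diff tendsto_scaleR tendsto_const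
        bounded_linear.tendsto[OF bl(1)] bounded_linear.tendsto[OF bl(2)] lim_y lim_\<omega>)
  then show ?thesis by (simp add: limit_feasible)
qed

lemma limit_block_optimal:
  assumes i: "i \<in> {1..s}"
  shows "\<bar>g i (block blk i xs)\<bar> \<noteq> \<infinity>"
    and "\<And>v. v \<in> block_space blk i \<Longrightarrow>
      g i (block blk i xs) + ereal (u i (block blk i xs) xs + adjoint (A i) \<omega>s \<bullet> block blk i xs)
      \<le> g i v + ereal (u i v xs + adjoint (A i) \<omega>s \<bullet> v + \<kappa> i * \<beta> / 2 * (norm (v - block blk i xs))\<^sup>2)"
  using limit_of_argmins[OF g(1)[OF i] g(2)[OF i] u(2)[OF i] x_update[OF i] block_in_block_space
      lim_block[OF lim_x_Suc] lim_partial_x lim_linear_coef[OF i] lim_xbar[OF i]]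
  by blast+

lemma F_limit_finite: "\<bar>F xs\<bar> \<noteq> \<infinity>"
proof -
  have "g i (block blk i xs) = ereal (real_of_ereal (g i (block blk i xs)))" if "i \<in> {1..s}" for i
    using limit_block_optimal(1)[OF that] by (simp add: ereal_real)
  then have "(\<Sum>i = 1..s. g i (block blk i xs)) = (\<Sum>i = 1..s. ereal (real_of_ereal (g i (block blk i xs))))"
    by (rule sum.cong[OF refl])
  then show ?thesis by (simp add: F composite_obj_def)
qed

lemma block_adjoint:
  assumes i: "i \<in> {1..s}"
  shows "block blk i (adjoint (block_map blk s A) w) = adjoint (A i) w"
  by (rule block_adjoint_block_map) (use A i in blast)+

text \<open>
  The limit point minimizes the limiting subproblem in block \<open>i\<close>. The function \<open>e'\<close>, which adds the
  proximal term to the surrogate error, has derivative zero there, so minimality says that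
  \<open>-A\<^sub>i\<^sup>*\<omega>\<^sup>*\<close> is the slope of a minorant of \<open>F\<close> in this block up to a first-order small error.
\<close>

lemma limit_block_stationary:
  assumes i: "i \<in> {1..s}"
  shows "- adjoint (A i) \<omega>s \<in> block_subdiff blk i F xs"
proof -
  let ?S = "block_space blk i" and ?p = "block blk i xs" and ?c = "adjoint (A i) \<omega>s"
  define G where "G = (\<Sum>j\<in>{1..s} - {i}. g j (block blk j xs))"
  have F_eq: "F (with_block blk i v xs) = ereal (f (with_block blk i v xs)) + (g i v + G)"
    if "v \<in> ?S" for v
    unfolding F G_def by (rule composite_obj_with_block[OF i that])
  have fin: "\<bar>F (with_block blk i ?p xs)\<bar> \<noteq> \<infinity>"
    using F_limit_finite by simp
  obtain gp where gp: "g i ?p = ereal gp"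
    using limit_block_optimal(1)[OF i] by (cases "g i ?p") auto
  obtain G' where G': "G = ereal G'"
    using fin F_eq[of ?p] gp by (cases G) auto
  obtain e where e: "e ?p = 0" "cont_diff_at_on ?S e ?p 0"
      "\<And>v. v \<in> ?S \<Longrightarrow> u i v xs - f (with_block blk i v xs) \<le> e v"
    using u(3)[OF i] unfolding surrogate_error_bound_def by blast
  define e' where "e' v = e v + \<kappa> i * \<beta> / 2 * ((v - ?p) \<bullet> (v - ?p))" for v
  have c_space: "?c \<in> ?S"
    using block_in_block_space[of blk i "adjoint (block_map blk s A) \<omega>s"] by (simp add: block_adjoint[OF i])
  have "- ?c \<in> frechet_subdiff_on ?S (\<lambda>v. F (with_block blk i v xs)) ?p"
  proof (rule frechet_subdiff_on_minorant)
    show "- ?c \<in> ?S" using c_space by (simp add: block_space_def)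
    have "(e has_derivative (\<lambda>t. 0)) (at ?p within ?S)"
      using e(2) unfolding cont_diff_at_on_def by (auto dest!: bspec[of _ _ ?p])
    moreover have "((\<lambda>v. (v - ?p) \<bullet> (v - ?p)) has_derivative (\<lambda>t. 0)) (at ?p within ?S)"
      by (auto intro!: derivative_eq_intros)
    ultimately show "(e' has_derivative (\<lambda>t. 0)) (at ?p within ?S)"
      unfolding e'_def[abs_def] by (auto intro!: derivative_eq_intros)
    show "e' ?p = 0" by (simp add: e'_def e)
  next
    fix v assume v: "v \<in> ?S"
    have up: "u i ?p xs = f xs" using u(1)[OF i] by (simp add: block_surrogate_def)
    have opt: "ereal (gp + (f xs + ?c \<bullet> ?p))
        \<le> g i v + ereal (u i v xs + ?c \<bullet> v + \<kappa> i * \<beta> / 2 * (norm (v - ?p))\<^sup>2)"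
      using limit_block_optimal(2)[OF i v] by (simp add: gp up)
    show "F (with_block blk i ?p xs) + ereal (- ?c \<bullet> (v - ?p) - e' v) \<le> F (with_block blk i v xs)"
    proof (cases "g i v")
      case (real \<gamma>v)
      have "gp + (f xs + ?c \<bullet> ?p) \<le> \<gamma>v + (u i v xs + ?c \<bullet> v + \<kappa> i * \<beta> / 2 * (norm (v - ?p))\<^sup>2)"
        using opt by (simp add: real)
      moreover note e(3)[OF v]
      moreover have "e' v = e v + \<kappa> i * \<beta> / 2 * (norm (v - ?p))\<^sup>2"
        by (simp add: e'_def power2_norm_eq_inner)
      ultimately have "f xs + (gp + G') + (- ?c \<bullet> (v - ?p) - e' v)
          \<le> f (with_block blk i v xs) + (\<gamma>v + G')"
        by (simp add: inner_diff_right)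
      then show ?thesis
        unfolding F_eq[OF v] F_eq[OF block_in_block_space] by (simp add: gp G' real)
    next
      case PInf
      then show ?thesis unfolding F_eq[OF v] by (simp add: G')
    next
      case MInf
      then show ?thesis using g(1)[OF i] v by (simp add: proper_on_def)
    qed
  qed (use fin in auto)
  then show ?thesis
    unfolding block_subdiff_def using frechet_subdiff_on_subset_limiting by blast
qed

text \<open>
  Taking limits in the multiplier recursion gives \<open>B\<^sup>*\<omega>\<^sup>* = (1 - \<alpha>) B\<^sup>*\<omega>\<^sup>* - \<alpha> \<nabla>h(y\<^sup>*)\<close>.
\<close>

lemma limit_y_stationary: "gh ys + adjoint B \<omega>s = 0"
proof -
  interpret B': linear "adjoint B" using B by (rule adjoint_linear)
  have bl: "bounded_linear (adjoint B)"
    using adjoint_linear[OF B] by (simp add: linear_linear)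
  have gh: "(\<lambda>k. gh (y (r k))) \<longlonglongrightarrow> gh ys"
    using lipschitz_on_continuous_on[OF h(2)] lim_y
    by (auto intro: continuous_on_tendsto_compose)
  have "(\<lambda>k. h_model_grad (r k)) \<longlonglongrightarrow> gh ys"
    using tendsto_add[OF along_r[OF h_model_grad_tendsto] gh] by simp
  then have "(\<lambda>k. (1 - \<alpha>) *\<^sub>R adjoint B (\<omega> (r k)) - \<alpha> *\<^sub>R h_model_grad (r k))
      \<longlonglongrightarrow> (1 - \<alpha>) *\<^sub>R adjoint B \<omega>s - \<alpha> *\<^sub>R gh ys"
    by (intro tendsto_diff tendsto_scaleR tendsto_const bounded_linear.tendsto[OF bl] lim_\<omega>)
  then have "(\<lambda>k. adjoint B (\<omega> (Suc (r k)))) \<longlonglongrightarrow> (1 - \<alpha>) *\<^sub>R adjoint B \<omega>s - \<alpha> *\<^sub>R gh ys"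
    by (simp only: multiplier_recursion)
  moreover have "(\<lambda>k. \<omega> (Suc (r k))) \<longlonglongrightarrow> \<omega>s"
    using tendsto_add[OF lim_\<omega> along_r[OF multiplier_step_tendsto_0]] by simp
  then have "(\<lambda>k. adjoint B (\<omega> (Suc (r k)))) \<longlonglongrightarrow> adjoint B \<omega>s"
    by (rule bounded_linear.tendsto[OF bl])
  ultimately have "(1 - \<alpha>) *\<^sub>R adjoint B \<omega>s - \<alpha> *\<^sub>R gh ys = adjoint B \<omega>s"
    by (rule LIMSEQ_unique)
  then have "\<alpha> *\<^sub>R (gh ys + adjoint B \<omega>s) = 0" by (simp add: algebra_simps)
  then show ?thesis using \<alpha> by simp
qed

text \<open>
  The smooth part of the augmented Lagrangian has gradient \<open>(A\<^sup>*\<omega>\<^sup>*, 0, 0)\<close> at the limit point, by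
  feasibility and stationarity in \<open>y\<close>; the first component cancels the subgradient of \<open>F\<close>.
\<close>

lemma limit_point_critical:
  assumes subdiff_F: "limiting_subdiff F xs =
      {v. \<forall>i\<in>{1..s}. block blk i v \<in> block_subdiff blk i F xs}"
  shows "critical_point (aug_lagrangian F h (block_map blk s A) B b \<beta>) (xs, ys, \<omega>s)"
proof -
  let ?A = "block_map blk s A"
  let ?\<phi> = "\<lambda>(x, y, \<omega>). h y + \<omega> \<bullet> (?A x + B y - b) + \<beta> / 2 * (norm (?A x + B y - b))\<^sup>2"
  let ?G = "\<lambda>(x, y, \<omega>). (adjoint ?A (\<omega> + \<beta> *\<^sub>R (?A x + B y - b)),
      gh y + adjoint B (\<omega> + \<beta> *\<^sub>R (?A x + B y - b)), ?A x + B y - b)"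
  have lin: "linear ?A" by (rule linear_block_map) (rule A(1))
  have "block blk i (- adjoint ?A \<omega>s) = - adjoint (A i) \<omega>s" if "i \<in> {1..s}" for i
    by (simp add: linear_neg[OF linear_block] block_adjoint[OF that])
  then have sub_F: "- adjoint ?A \<omega>s \<in> limiting_subdiff F xs"
    unfolding subdiff_F using limit_block_stationary by simp
  have grad: "GDERIV ?\<phi> p :> ?G p" for p
  proof -
    obtain x' y' \<omega>' where p: "p = (x', y', \<omega>')" by (cases p)
    show ?thesis unfolding p prod.case by (rule gradient_augmented_terms[OF lin B h(1)])
  qed
  have "continuous_on UNIV gh" by (rule lipschitz_on_continuous_on[OF h(2)])
  then have cont_gh: "continuous_on UNIV (\<lambda>p. gh (fst (snd p)))"
    by (rule continuous_on_compose2) (auto intro!: continuous_intros)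
  have "continuous_on UNIV (\<lambda>p. ?G p)"
    unfolding case_prod_beta
    by (intro continuous_on_Pair continuous_on_add continuous_on_diff continuous_on_scaleR
        continuous_on_const cont_gh continuous_on_fst continuous_on_snd continuous_on_id
        linear_continuous_on_compose[of UNIV _ ?A] linear_continuous_on_compose[of UNIV _ B]
        linear_continuous_on_compose[of UNIV _ "adjoint ?A"]
        linear_continuous_on_compose[of UNIV _ "adjoint B"] lin B adjoint_linear)
  then have "continuous (at (xs, ys, \<omega>s)) ?G"
    by (simp add: continuous_on_eq_continuous_at)
  from limiting_subdiff_add_smooth[OF sub_F grad this]
  have "(- adjoint ?A \<omega>s, 0) + ?G (xs, ys, \<omega>s)
      \<in> limiting_subdiff (\<lambda>(x, y). F x + ereal (?\<phi> (x, y))) (xs, ys, \<omega>s)" .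
  moreover have "(- adjoint ?A \<omega>s, 0) + ?G (xs, ys, \<omega>s) = 0"
    using limit_y_stationary by (simp add: limit_feasible zero_prod_def)
  moreover have "(\<lambda>(x, y). F x + ereal (?\<phi> (x, y))) = aug_lagrangian F h ?A B b \<beta>"
    by (auto simp: aug_lagrangian_def fun_eq_iff)
  ultimately have "0 \<in> limiting_subdiff (aug_lagrangian F h ?A B b \<beta>) (xs, ys, \<omega>s)"
    by (simp only:)
  then show ?thesis
    unfolding critical_point_def limiting_subdiff_on_def by auto
qed

end

end

section \<open>Critical points of the augmented Lagrangian\<close>

theorem theorem1:
  fixes blk :: "'n::finite \<Rightarrow> nat" and s :: nat
    and f :: "real^'n \<Rightarrow> real" and g :: "nat \<Rightarrow> real^'n \<Rightarrow> ereal"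
    and h :: "real^'q::finite \<Rightarrow> real" and gh :: "real^'q \<Rightarrow> real^'q" and L\<^sub>h :: real
    and A :: "nat \<Rightarrow> real^'n \<Rightarrow> real^'m::finite" and B :: "real^'q \<Rightarrow> real^'m" and b :: "real^'m"
    and u :: "nat \<Rightarrow> real^'n \<Rightarrow> real^'n \<Rightarrow> real"
    and F :: "real^'n \<Rightarrow> ereal"
    and \<alpha> \<beta> \<sigma>\<^sub>B \<alpha>\<^sub>2 \<mu> \<eta>\<^sub>y \<nu>\<^sub>y C\<^sub>x C\<^sub>y C\<^sub>1 C\<^sub>2 :: real
    and \<kappa> \<nu> \<eta> \<delta> \<delta>bar \<gamma>\<^sub>y :: "nat \<Rightarrow> real" and \<zeta> \<gamma> :: "nat \<Rightarrow> nat \<Rightarrow> real"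
    and x :: "nat \<Rightarrow> real^'n" and y :: "nat \<Rightarrow> real^'q" and \<omega> :: "nat \<Rightarrow> real^'m"
    and xs :: "real^'n" and ys :: "real^'q" and \<omega>s :: "real^'m"
  assumes blk: "blk ` UNIV = {1..s}"
    \<comment> \<open>the problem data; \<open>A i\<close> is a linear map of the \<open>i\<close>-th block only\<close>
    and A: "\<And>i. i \<in> {1..s} \<Longrightarrow> linear (A i)"
           "\<And>i v. i \<in> {1..s} \<Longrightarrow> A i v = A i (block blk i v)"
    and B: "linear B"
    and g: "\<And>i. i \<in> {1..s} \<Longrightarrow> proper_on (block_space blk i) (g i)"
           "\<And>i. i \<in> {1..s} \<Longrightarrow> lsc_on (block_space blk i) (g i)"
    and F: "F = composite_obj blk s f g"
    and subdiff_F: "\<And>z. limiting_subdiff F z =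
           {v. \<forall>i\<in>{1..s}. block blk i v \<in> block_subdiff blk i F z}"
    and bdd_below: "\<exists>c::real. \<forall>z w. ereal c \<le> F z + ereal (h w)"
    and h: "\<And>w. GDERIV h w :> gh w" "L\<^sub>h-lipschitz_on UNIV gh"
    and \<sigma>\<^sub>B: "\<sigma>\<^sub>B = lambda_min (B \<circ> adjoint B)" "\<sigma>\<^sub>B > 0"
    \<comment> \<open>the surrogates\<close>
    and u: "\<And>i. i \<in> {1..s} \<Longrightarrow> block_surrogate blk i f (u i)"
           "\<And>i. i \<in> {1..s} \<Longrightarrow> continuous_on (block_space blk i \<times> UNIV) (\<lambda>(v, z). u i v z)"
           "\<And>i. i \<in> {1..s} \<Longrightarrow> surrogate_error_bound blk i f (u i)"
    \<comment> \<open>the parameters\<close>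
    and \<alpha>: "0 < \<alpha>" "\<alpha> < 2"
    and \<beta>: "\<beta> > 0"
    and \<alpha>\<^sub>2: "\<alpha>\<^sub>2 = 3 * \<alpha> / (\<sigma>\<^sub>B * (1 - \<bar>1 - \<alpha>\<bar>)\<^sup>2)"
    and \<delta>bar: "\<And>k. \<delta>bar k = (if \<forall>l. \<delta> l = 0 then 2 else 4 * (1 + \<delta> k)\<^sup>2)"
    and \<nu>: "\<And>i. i \<in> {1..s} \<Longrightarrow> if \<forall>k. \<zeta> i k = 0 then \<nu> i = 0 else 0 < \<nu> i \<and> \<nu> i < 1"
    and \<nu>\<^sub>y: "if \<forall>k. \<delta> k = 0 then \<nu>\<^sub>y = 0 else 0 < \<nu>\<^sub>y \<and> \<nu>\<^sub>y < 1"
    \<comment> \<open>the general choice, or the choice available for convex block subproblems\<close>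
    and \<kappa>_\<eta>_\<gamma>: "\<And>i. i \<in> {1..s} \<Longrightarrow>
           (let a = onorm (adjoint (A i) \<circ> A i) in
              (\<kappa> i > a \<and>
               \<eta> i = (1 - \<nu> i) * (\<kappa> i - a) * \<beta> / 2 \<and>
               (\<forall>k. \<gamma> i k = (\<beta> * \<zeta> i k * (\<kappa> i + a))\<^sup>2 / (2 * \<nu> i * (\<kappa> i - a) * \<beta>)))
            \<or> ((\<forall>z. ereal_convex_on (block_space blk i) (\<lambda>v. ereal (u i v z) + g i v)) \<and>
               \<kappa> i = a \<and>
               \<eta> i = \<beta> * a / 2 \<and>
               (\<forall>k. \<gamma> i k = \<beta> * a * (\<zeta> i k)\<^sup>2 / 2)))"
    and \<eta>\<^sub>y: "\<eta>\<^sub>y = (if convex_on UNIV h then L\<^sub>h / 2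
                 else (1 - \<nu>\<^sub>y) * (\<beta> * lambda_min (adjoint B \<circ> B) + L\<^sub>h) / 2)"
    and \<gamma>\<^sub>y: "\<And>k. \<gamma>\<^sub>y k = (if convex_on UNIV h then L\<^sub>h * (\<delta> k)\<^sup>2 / 2
                 else 2 * L\<^sub>h\<^sup>2 * (\<delta> k)\<^sup>2 / (\<nu>\<^sub>y * (\<beta> * lambda_min (adjoint B \<circ> B) + L\<^sub>h)))"
    and seq: "iADMM_sequence blk s u g gh L\<^sub>h A B b \<alpha> \<beta> \<kappa> \<zeta> \<delta> x y \<omega>"
    \<comment> \<open>the conditions on the parameters\<close>
    and \<mu>: "\<mu> = \<eta>\<^sub>y - \<alpha>\<^sub>2 * L\<^sub>h\<^sup>2 / \<beta>" "\<mu> > 0"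
    and \<eta>: "\<And>i. i \<in> {1..s} \<Longrightarrow> \<eta> i > 0"
    and C: "0 < C\<^sub>x" "C\<^sub>x < 1" "0 < C\<^sub>y" "C\<^sub>y < 1"
    and C\<^sub>1\<^sub>2: "if \<forall>k. \<delta> k = 0 then C\<^sub>1 = C\<^sub>y \<and> C\<^sub>2 = 0
              else 0 < C\<^sub>1 \<and> C\<^sub>1 < C\<^sub>y \<and> C\<^sub>2 = C\<^sub>y - C\<^sub>1"
    and cond_x: "\<And>k i. k \<ge> 1 \<Longrightarrow> i \<in> {1..s} \<Longrightarrow> \<gamma> i k \<le> C\<^sub>x * \<eta> i"
    and cond_y: "\<And>k. k \<ge> 1 \<Longrightarrow> 4 * \<alpha>\<^sub>2 * L\<^sub>h\<^sup>2 * (\<delta> (k - 1))\<^sup>2 / \<beta> \<le> C\<^sub>2 * \<mu>"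
                "\<And>k. k \<ge> 1 \<Longrightarrow> \<alpha>\<^sub>2 * L\<^sub>h\<^sup>2 * \<delta>bar k / \<beta> + \<gamma>\<^sub>y k \<le> C\<^sub>1 * \<mu>"
    and alternatives: "(\<forall>k. \<delta> k = 0) \<or>
           (\<not> (\<forall>k. \<delta> k = 0) \<and>
            (\<forall>k\<ge>1. \<beta> \<ge> 4 * L\<^sub>h * \<alpha> / (\<sigma>\<^sub>B * (1 - \<bar>1 - \<alpha>\<bar>)) \<and>
                    \<beta> \<ge> 6 * \<alpha> * L\<^sub>h\<^sup>2 / (\<mu> * \<sigma>\<^sub>B * (1 - \<bar>1 - \<alpha>\<bar>))
                         * max 1 (12 * (\<delta> k)\<^sup>2 / (1 - C\<^sub>1))))"
    and bounded: "bounded (range (\<lambda>k. (x k, y k, \<omega> k)))"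
    and limit_point: "\<exists>r. strict_mono r \<and> (\<lambda>k. (x (r k), y (r k), \<omega> (r k))) \<longlonglongrightarrow> (xs, ys, \<omega>s)"
  shows "critical_point (aug_lagrangian F h (block_map blk s A) B b \<beta>) (xs, ys, \<omega>s)"
proof -
  obtain r where r: "strict_mono r"
    and lim: "(\<lambda>k. (x (r k), y (r k), \<omega> (r k))) \<longlonglongrightarrow> (xs, ys, \<omega>s)"
    using limit_point by blast
  have "bounded (snd ` snd ` range (\<lambda>k. (x k, y k, \<omega> k)))"
    using bounded by (intro bounded_snd)
  then have bounded_\<omega>: "bounded (range \<omega>)" by (simp add: image_image)
  interpret iADMM_run blk s f g h gh L\<^sub>h A B b u F \<alpha> \<beta> \<sigma>\<^sub>B \<alpha>\<^sub>2 \<mu> \<eta>\<^sub>y \<nu>\<^sub>y C\<^sub>x C\<^sub>y C\<^sub>1 C\<^sub>2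
      \<kappa> \<nu> \<eta> \<delta> \<delta>bar \<gamma>\<^sub>y \<zeta> \<gamma> x y \<omega>
    by (rule iADMM_run.intro) (fact assms bounded_\<omega>)+
  show ?thesis
    using tendsto_fst[OF lim] tendsto_fst[OF tendsto_snd[OF lim]] tendsto_snd[OF tendsto_snd[OF lim]]
    by (intro limit_point_critical[OF r _ _ _ subdiff_F]) simp_all
qed

end
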